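(* Let $k$ be any field, let $N\subseteq \mathrm{GL}_{2,k}$ be the schematic normalizer of the diagonal torus, let $V$ be the standard comodule on $\mathrm{GL}_{2,k}$, and let $d\ge1$ be an integer. For each $i=0,\dots,d$ the comodule $(\mathrm{Sym}^d(V)^i,\Delta^i)$ is an irreducible $k[N]$-comodule.
   Context: Let $D=x_{11}x_{22}-x_{12}x_{21}$, $k[G]=k[x_{ij},1/D]$, $G=\mathrm{GL}_{2,k}=\mathrm{Spec}(k[G])$ with comultiplication $x_{ij}\mapsto\sum_l x_{il}\otimes x_{lj}$. Put $I_1=(x_{12},x_{21})$, $I_2=(x_{11},x_{22})$ and $k[N]=k[G]/I_1I_2\cong k[t_1^{\pm1},t_2^{\pm1}]\oplus k[u_1^{\pm1},u_2^{\pm1}]$, where $x_{11},x_{22},x_{12},x_{21}$ map to $(t_1,0),(t_2,0),(0,u_1),(0,u_2)$, written simply $t_1,t_2,u_1,u_2$; $N=\mathrm{Spec}(k[N])$ is the schematic normalizer of the diagonal torus $T=V(I_1)$. The standard comodule is $V=k\{e_1,e_2\}$ with $\Delta_V(e_1)=x_{11}\otimes e_1+x_{12}\otimes e_2$, $\Delta_V(e_2)=x_{21}\otimes e_1+x_{22}\otimes e_2$ in $k[G]\otimes_k V$. It induces a $k[N]$-comodule structure on $\mathrm{Sym}^d(V)$. Put $v_i=e_1^{d-i}e_2^i$ for $i=0,\dots,d$, and $\mathrm{Sym}^d(V)^i=k\{v_i,v_{d-i}\}$ (the $k$-span of $v_i$ and $v_{d-i}$, one-dimensional if $d=2i$), with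 the induced comodule map $\Delta^i:\mathrm{Sym}^d(V)^i\to k[N]\otimes_k\mathrm{Sym}^d(V)^i$ given by $$\Delta^i(v_i)=t_1^{d-i}t_2^i\otimes v_i+u_1^{d-i}u_2^i\otimes v_{d-i},\qquad \Delta^i(v_{d-i})=t_1^it_2^{d-i}\otimes v_{d-i}+u_1^iu_2^{d-i}\otimes v_i ,$$ where $t_1^at_2^b$ and $u_1^au_2^b$ denote $(t_1^at_2^b,0)$ and $(0,u_1^au_2^b)$ (when $d=2i$ the map is $\Delta^i(v_i)=(t_1^it_2^i+u_1^iu_2^i)\otimes v_i$). A comodule is irreducible if it is nonzero and has no subcomodules other than $0$ and itself. *)

theory Defs
  imports Complex_Main "HOL-Library.Poly_Mapping" "HOL-Library.Numeral_Type" "HOL-Library.Function_Algebras"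
begin

section \<open>Tensor products over a field\<close>

text \<open>
  Vector spaces over the field \<open>'k\<close> are types \<open>'a\<close> of class \<^class>\<open>ab_group_add\<close> together with a
  scalar multiplication \<open>sA\<close> satisfying \<^locale>\<open>vector_space\<close>.  The tensor product of \<open>A\<close> and \<open>B\<close>
  is realised inside the dual of the space of bilinear forms: \<open>a \<otimes> b\<close> is evaluation at \<open>(a, b)\<close>,
  and the tensor product is the span of these.  Since \<open>'k\<close> is a field, this is the usual
  tensor product; see \<open>tensor_relations\<close> below.  Functions that are not bilinear are sent to 0,
  so that equality of tensors only depends on the values at bilinear forms.
\<close>

type_synonym ('k, 'a, 'b) tensor = "('a \<Rightarrow> 'b \<Rightarrow> 'k) \<Rightarrow> 'k"
type_synonym ('k, 'a, 'b, 'c) tensor3 = "('a \<Rightarrow> 'b \<Rightarrow> 'c \<Rightarrow> 'k) \<Rightarrow> 'k"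

definition bilinear ::
  "('k::field \<Rightarrow> 'a::ab_group_add \<Rightarrow> 'a) \<Rightarrow> ('k \<Rightarrow> 'b::ab_group_add \<Rightarrow> 'b) \<Rightarrow>
   ('k \<Rightarrow> 'c::ab_group_add \<Rightarrow> 'c) \<Rightarrow> ('a \<Rightarrow> 'b \<Rightarrow> 'c) \<Rightarrow> bool"
  where "bilinear sA sB sC \<beta> \<longleftrightarrow>
    (\<forall>b. Vector_Spaces.linear sA sC (\<lambda>a. \<beta> a b)) \<and> (\<forall>a. Vector_Spaces.linear sB sC (\<beta> a))"

definition trilinear ::
  "('k::field \<Rightarrow> 'a::ab_group_add \<Rightarrow> 'a) \<Rightarrow> ('k \<Rightarrow> 'b::ab_group_add \<Rightarrow> 'b) \<Rightarrow>
   ('k \<Rightarrow> 'c::ab_group_add \<Rightarrow> 'c) \<Rightarrow> ('a \<Rightarrow> 'b \<Rightarrow> 'c \<Rightarrow> 'k) \<Rightarrow> bool"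
  where "trilinear sA sB sC \<gamma> \<longleftrightarrow>
    (\<forall>b c. Vector_Spaces.linear sA (*) (\<lambda>a. \<gamma> a b c)) \<and>
    (\<forall>a c. Vector_Spaces.linear sB (*) (\<lambda>b. \<gamma> a b c)) \<and>
    (\<forall>a b. Vector_Spaces.linear sC (*) (\<gamma> a b))"

definition tensor_scale :: "'k::field \<Rightarrow> ('f \<Rightarrow> 'k) \<Rightarrow> 'f \<Rightarrow> 'k"
  where "tensor_scale c T = (\<lambda>\<beta>. c * T \<beta>)"

definition tensor ::
  "('k::field \<Rightarrow> 'a::ab_group_add \<Rightarrow> 'a) \<Rightarrow> ('k \<Rightarrow> 'b::ab_group_add \<Rightarrow> 'b) \<Rightarrow>
   'a \<Rightarrow> 'b \<Rightarrow> ('k, 'a, 'b) tensor"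
  where "tensor sA sB a b = (\<lambda>\<beta>. if bilinear sA sB (*) \<beta> then \<beta> a b else 0)"

text \<open>For subspaces \<open>A\<close>, \<open>B\<close> this is \<open>A \<otimes> B\<close>, as a subspace of the tensor product of the
  ambient spaces.\<close>

definition tensor_product ::
  "('k::field \<Rightarrow> 'a::ab_group_add \<Rightarrow> 'a) \<Rightarrow> ('k \<Rightarrow> 'b::ab_group_add \<Rightarrow> 'b) \<Rightarrow>
   'a set \<Rightarrow> 'b set \<Rightarrow> ('k, 'a, 'b) tensor set"
  where "tensor_product sA sB A B = module.span tensor_scale {tensor sA sB a b |a b. a \<in> A \<and> b \<in> B}"

text \<open>For linear \<open>f\<close>, \<open>g\<close> the map \<open>f \<otimes> g\<close>; the scalar multiplications are those of the targets.\<close>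

definition tensor_map ::
  "('k::field \<Rightarrow> 'c::ab_group_add \<Rightarrow> 'c) \<Rightarrow> ('k \<Rightarrow> 'd::ab_group_add \<Rightarrow> 'd) \<Rightarrow>
   ('a \<Rightarrow> 'c) \<Rightarrow> ('b \<Rightarrow> 'd) \<Rightarrow> ('k, 'a, 'b) tensor \<Rightarrow> ('k, 'c, 'd) tensor"
  where "tensor_map sC sD f g T =
    (\<lambda>\<beta>. if bilinear sC sD (*) \<beta> then T (\<lambda>a b. \<beta> (f a) (g b)) else 0)"

lemma vector_space_mult: "vector_space ((*) :: 'k::field \<Rightarrow> 'k \<Rightarrow> 'k)"
  by unfold_locales (auto simp: algebra_simps)

lemma vector_space_tensor_scale: "vector_space (tensor_scale :: 'k::field \<Rightarrow> ('f \<Rightarrow> 'k) \<Rightarrow> 'f \<Rightarrow> 'k)"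
  by unfold_locales (auto simp: tensor_scale_def algebra_simps fun_eq_iff)

lemma bilinear_compose:
  assumes "bilinear sA sB sC \<beta>" "Vector_Spaces.linear sC sD f"
  shows "bilinear sA sB sD (\<lambda>a b. f (\<beta> a b))"
  using assms Vector_Spaces.linear_compose[of sA sC _ sD f] Vector_Spaces.linear_compose[of sB sC _ sD f]
  unfolding bilinear_def by (auto simp: o_def)

lemma bilinear_compose2:
  assumes "bilinear sC sD sE \<beta>" "Vector_Spaces.linear sA sC f" "Vector_Spaces.linear sB sD g"
  shows "bilinear sA sB sE (\<lambda>a b. \<beta> (f a) (g b))"
  using assms Vector_Spaces.linear_compose[of sA sC f sE] Vector_Spaces.linear_compose[of sB sD g sE]
  unfolding bilinear_def by (auto simp: o_def)

lemma bilinear_tensor: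
  assumes "vector_space sA" "vector_space sB"
  shows "bilinear sA sB tensor_scale (tensor sA sB)"
proof -
  interpret T: vector_space "tensor_scale :: 'a \<Rightarrow> (('b \<Rightarrow> 'c \<Rightarrow> 'a) \<Rightarrow> 'a) \<Rightarrow> _"
    by (rule vector_space_tensor_scale)
  interpret A: vector_space sA by fact
  interpret B: vector_space sB by fact
  show ?thesis unfolding bilinear_def
  proof (intro conjI allI)
    fix b show "Vector_Spaces.linear sA tensor_scale (\<lambda>a. tensor sA sB a b)"
      by unfold_locales
        (auto simp: tensor_def bilinear_def tensor_scale_def fun_eq_iff
          dest: spec[of _ b] simp: Vector_Spaces.linear_iff)
  next
    fix a show "Vector_Spaces.linear sB tensor_scale (tensor sA sB a)"
      by unfold_locales
        (auto simp: tensor_def bilinear_def tensor_scale_def fun_eq_iff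
          dest: spec[of _ a] simp: Vector_Spaces.linear_iff)
  qed
qed

lemma tensor_map_tensor:
  assumes "Vector_Spaces.linear sA sC f" "Vector_Spaces.linear sB sD g"
  shows "tensor_map sC sD f g (tensor sA sB a b) = tensor sC sD (f a) (g b)"
  using bilinear_compose2[OF _ assms] by (auto simp: tensor_map_def tensor_def fun_eq_iff)

lemma tensor_simps:
  assumes "vector_space sA" "vector_space sB"
  shows "tensor sA sB (a + a') b = tensor sA sB a b + tensor sA sB a' b"
    and "tensor sA sB a (b + b') = tensor sA sB a b + tensor sA sB a b'"
    and "tensor sA sB (sA c a) b = tensor_scale c (tensor sA sB a b)"
    and "tensor sA sB a (sB c b) = tensor_scale c (tensor sA sB a b)"
    and "tensor sA sB 0 b = 0"
    and "tensor sA sB a 0 = 0"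
proof -
  have 1: "Vector_Spaces.linear sA tensor_scale (\<lambda>a. tensor sA sB a b)" for b
    using bilinear_tensor[OF assms] by (simp add: bilinear_def)
  have 2: "Vector_Spaces.linear sB tensor_scale (tensor sA sB a)" for a
    using bilinear_tensor[OF assms] by (simp add: bilinear_def)
  show "tensor sA sB (a + a') b = tensor sA sB a b + tensor sA sB a' b"
    "tensor sA sB (sA c a) b = tensor_scale c (tensor sA sB a b)"
    using 1[of b] by (simp_all add: Vector_Spaces.linear_iff)
  show "tensor sA sB a (b + b') = tensor sA sB a b + tensor sA sB a b'"
    "tensor sA sB a (sB c b) = tensor_scale c (tensor sA sB a b)"
    using 2[of a] by (simp_all add: Vector_Spaces.linear_iff)
  show "tensor sA sB 0 b = 0"
    using module_hom.zero[OF module_hom_iff_linear[THEN iffD2, OF 1[of b]]] .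
  show "tensor sA sB a 0 = 0"
    using module_hom.zero[OF module_hom_iff_linear[THEN iffD2, OF 2[of a]]] .
qed

text \<open>Universal property: a relation between elementary tensors holds only if it holds for
  every bilinear map.\<close>

lemma tensor_relations:
  assumes f: "bilinear sA sB sC f" and fin: "finite I"
    and zero: "(\<Sum>i\<in>I. tensor sA sB (a i) (b i)) = 0"
  shows "(\<Sum>i\<in>I. f (a i) (b i)) = 0"
proof (rule ccontr)
  define w where "w = (\<Sum>i\<in>I. f (a i) (b i))"
  assume "(\<Sum>i\<in>I. f (a i) (b i)) \<noteq> 0"
  then have w: "w \<noteq> 0" by (simp add: w_def)
  interpret C: vector_space sC
    using f unfolding bilinear_def by (auto simp: Vector_Spaces.linear_iff)
  interpret K: vector_space "(*) :: 'a \<Rightarrow> 'a \<Rightarrow> 'a" by (rule vector_space_mult)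
  interpret CK: vector_space_pair sC "(*) :: 'a \<Rightarrow> 'a \<Rightarrow> 'a" ..
  have ind: "C.independent {w}" using w by simp
  obtain \<phi> where \<phi>: "Vector_Spaces.linear sC (*) \<phi>" "\<phi> w = (1::'a)"
    using CK.linear_construct[OF ind, of "\<lambda>_. 1"] CK.construct_basis[OF ind, of w "\<lambda>_. 1"] by auto
  interpret \<phi>: Vector_Spaces.linear sC "(*)" \<phi> by fact
  have bil: "bilinear sA sB (*) (\<lambda>a b. \<phi> (f a b))" by (rule bilinear_compose[OF f \<phi>(1)])
  have "(\<Sum>i\<in>I. tensor sA sB (a i) (b i)) \<beta> = (\<Sum>i\<in>I. tensor sA sB (a i) (b i) \<beta>)" for \<beta>
    using fin by (induction I rule: finite_induct) auto
  from this[of "\<lambda>a b. \<phi> (f a b)"] have "\<phi> w = 0"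
    using zero bil by (simp add: w_def \<phi>.sum tensor_def)
  with \<phi> show False by simp
qed


section \<open>Comodules\<close>

text \<open>
  \<open>C\<close> is a coalgebra with comultiplication \<open>\<Delta>\<close> and counit \<open>\<epsilon>\<close>, and \<open>\<rho>\<close> maps a vector space
  \<open>V\<close> linearly to \<open>C \<otimes> V\<close>.  The next two maps are \<open>\<Delta> \<otimes> id\<close> and \<open>id \<otimes> \<rho>\<close> from \<open>C \<otimes> V\<close> to
  \<open>C \<otimes> C \<otimes> V\<close>, the latter again realised by evaluation at trilinear forms.
\<close>

definition comult_tensor_id ::
  "('k::field \<Rightarrow> 'c::ab_group_add \<Rightarrow> 'c) \<Rightarrow> ('k \<Rightarrow> 'v::ab_group_add \<Rightarrow> 'v) \<Rightarrow>
   ('c \<Rightarrow> ('k, 'c, 'c) tensor) \<Rightarrow> ('k, 'c, 'v) tensor \<Rightarrow> ('k, 'c, 'c, 'v) tensor3"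
  where "comult_tensor_id sC sV \<Delta> T =
    (\<lambda>\<gamma>. if trilinear sC sC sV \<gamma> then T (\<lambda>c v. \<Delta> c (\<lambda>a b. \<gamma> a b v)) else 0)"

definition id_tensor_coaction ::
  "('k::field \<Rightarrow> 'c::ab_group_add \<Rightarrow> 'c) \<Rightarrow> ('k \<Rightarrow> 'v::ab_group_add \<Rightarrow> 'v) \<Rightarrow>
   ('v \<Rightarrow> ('k, 'c, 'v) tensor) \<Rightarrow> ('k, 'c, 'v) tensor \<Rightarrow> ('k, 'c, 'c, 'v) tensor3"
  where "id_tensor_coaction sC sV \<rho> T =
    (\<lambda>\<gamma>. if trilinear sC sC sV \<gamma> then T (\<lambda>a v. \<rho> v (\<lambda>b w. \<gamma> a b w)) else 0)"

text \<open>
  \<open>(W, \<rho>)\<close> is a left \<open>C\<close>-comodule, where \<open>W\<close> is a subspace of an ambient space on which \<open>\<rho>\<close> is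
  defined and linear; the comodule map is the restriction of \<open>\<rho>\<close> to \<open>W\<close>.  The counit axiom uses
  the identification of \<open>v\<close> with \<open>1 \<otimes> v\<close>.
\<close>

definition comodule ::
  "('k::field \<Rightarrow> 'c::ab_group_add \<Rightarrow> 'c) \<Rightarrow> ('c \<Rightarrow> ('k, 'c, 'c) tensor) \<Rightarrow> ('c \<Rightarrow> 'k) \<Rightarrow>
   ('k \<Rightarrow> 'v::ab_group_add \<Rightarrow> 'v) \<Rightarrow> 'v set \<Rightarrow> ('v \<Rightarrow> ('k, 'c, 'v) tensor) \<Rightarrow> bool"
  where "comodule sC \<Delta> \<epsilon> sV W \<rho> \<longleftrightarrow>
    module.subspace sV W \<and> Vector_Spaces.linear sV tensor_scale \<rho> \<and>
    (\<forall>w\<in>W. \<rho> w \<in> tensor_product sC sV UNIV W) \<and>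
    (\<forall>w\<in>W. comult_tensor_id sC sV \<Delta> (\<rho> w) = id_tensor_coaction sC sV \<rho> (\<rho> w)) \<and>
    (\<forall>w\<in>W. tensor_map (*) sV \<epsilon> id (\<rho> w) = tensor (*) sV 1 w)"

definition subcomodule ::
  "('k::field \<Rightarrow> 'c::ab_group_add \<Rightarrow> 'c) \<Rightarrow> ('k \<Rightarrow> 'v::ab_group_add \<Rightarrow> 'v) \<Rightarrow>
   'v set \<Rightarrow> 'v set \<Rightarrow> ('v \<Rightarrow> ('k, 'c, 'v) tensor) \<Rightarrow> bool"
  where "subcomodule sC sV U W \<rho> \<longleftrightarrow>
    module.subspace sV U \<and> U \<subseteq> W \<and> (\<forall>u\<in>U. \<rho> u \<in> tensor_product sC sV UNIV U)"

definition irreducible_comodule ::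
  "('k::field \<Rightarrow> 'c::ab_group_add \<Rightarrow> 'c) \<Rightarrow> ('c \<Rightarrow> ('k, 'c, 'c) tensor) \<Rightarrow> ('c \<Rightarrow> 'k) \<Rightarrow>
   ('k \<Rightarrow> 'v::ab_group_add \<Rightarrow> 'v) \<Rightarrow> 'v set \<Rightarrow> ('v \<Rightarrow> ('k, 'c, 'v) tensor) \<Rightarrow> bool"
  where "irreducible_comodule sC \<Delta> \<epsilon> sV W \<rho> \<longleftrightarrow>
    comodule sC \<Delta> \<epsilon> sV W \<rho> \<and> W \<noteq> {0} \<and>
    (\<forall>U. subcomodule sC sV U W \<rho> \<longrightarrow> U = {0} \<or> U = W)"


section \<open>Polynomials and ideals\<close>

type_synonym ('i, 'r) mpoly = "('i \<Rightarrow>\<^sub>0 nat) \<Rightarrow>\<^sub>0 'r"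

definition mconst :: "'r \<Rightarrow> ('i, 'r::comm_ring_1) mpoly"
  where "mconst c = Poly_Mapping.single 0 c"

definition mvar :: "'i \<Rightarrow> ('i, 'r::comm_ring_1) mpoly"
  where "mvar i = Poly_Mapping.single (Poly_Mapping.single i 1) 1"

definition mscale :: "'r \<Rightarrow> ('i, 'r::comm_ring_1) mpoly \<Rightarrow> ('i, 'r) mpoly"
  where "mscale c p = mconst c * p"

definition meval :: "('r::comm_ring_1 \<Rightarrow> 's::comm_ring_1) \<Rightarrow> ('i \<Rightarrow> 's) \<Rightarrow> ('i, 'r) mpoly \<Rightarrow> 's"
  where "meval \<phi> x p = (\<Sum>m\<in>Poly_Mapping.keys p. \<phi> (Poly_Mapping.lookup p m) *
    (\<Prod>i\<in>Poly_Mapping.keys m. x i ^ Poly_Mapping.lookup m i))"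

text \<open>The canonical isomorphism from \<open>A[x]\<close> to \<open>A \<otimes> k[x]\<close>, sending \<open>\<Sum> a\<^sub>m x\<^sup>m\<close> to
  \<open>\<Sum> a\<^sub>m \<otimes> x\<^sup>m\<close>.\<close>

definition mpoly_tensor ::
  "('k::field \<Rightarrow> 'a::comm_ring_1 \<Rightarrow> 'a) \<Rightarrow> ('i, 'a) mpoly \<Rightarrow> ('k, 'a, ('i, 'k) mpoly) tensor"
  where "mpoly_tensor sA q = (\<Sum>m\<in>Poly_Mapping.keys q.
    tensor sA mscale (Poly_Mapping.lookup q m) (Poly_Mapping.single m 1))"

definition is_ideal :: "'a::comm_ring_1 set \<Rightarrow> bool"
  where "is_ideal = module.subspace (*)"

definition ideal_of :: "'a::comm_ring_1 set \<Rightarrow> 'a set"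
  where "ideal_of = module.span (*)"

definition ideal_prod :: "'a::comm_ring_1 set \<Rightarrow> 'a set \<Rightarrow> 'a set"
  where "ideal_prod I J = ideal_of {a * b |a b. a \<in> I \<and> b \<in> J}"

lemma module_times: "module ((*) :: 'a::comm_ring_1 \<Rightarrow> 'a \<Rightarrow> 'a)"
  by unfold_locales (auto simp: algebra_simps)

lemma is_ideal_iff:
  "is_ideal J \<longleftrightarrow> 0 \<in> J \<and> (\<forall>a\<in>J. \<forall>b\<in>J. a + b \<in> J) \<and> (\<forall>c. \<forall>a\<in>J. c * a \<in> J)"
  unfolding is_ideal_def by (auto simp: module.subspace_def[OF module_times])

lemma is_ideal_ideal_of: "is_ideal (ideal_of S)"
  unfolding is_ideal_def ideal_of_def by (rule module.subspace_span[OF module_times])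

lemma ideal_of_base: "a \<in> S \<Longrightarrow> a \<in> ideal_of S"
  unfolding ideal_of_def by (rule module.span_base[OF module_times])

lemma ideal_of_minimal: "S \<subseteq> J \<Longrightarrow> is_ideal J \<Longrightarrow> ideal_of S \<subseteq> J"
  unfolding is_ideal_def ideal_of_def by (rule module.span_minimal[OF module_times])

locale comm_ring_morphism =
  fixes f :: "'r::comm_ring_1 \<Rightarrow> 's::comm_ring_1"
  assumes hom_one: "f 1 = 1" and hom_add: "f (a + b) = f a + f b" and hom_mult: "f (a * b) = f a * f b"
begin

lemma hom_zero: "f 0 = 0"
  using hom_add[of 0 0] by simp

lemma hom_uminus: "f (- a) = - f a"
  using hom_add[of a "- a"] by (simp add: hom_zero eq_neg_iff_add_eq_0 add.commute)

lemma hom_diff: "f (a - b) = f a - f b"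
  using hom_add[of a "- b"] by (simp add: hom_uminus)

lemma hom_ideal_of:
  assumes "a \<in> ideal_of S" "\<And>s. s \<in> S \<Longrightarrow> f s \<in> J" "is_ideal J"
  shows "f a \<in> J"
proof -
  have "is_ideal {a. f a \<in> J}"
    using assms(3) by (simp add: is_ideal_iff hom_zero hom_add hom_mult)
  then show ?thesis using ideal_of_minimal[of S "{a. f a \<in> J}"] assms(1,2) by auto
qed

end

lemma ideal_quotient_simps:
  fixes J :: "'a::comm_ring_1 set"
  assumes "is_ideal J"
  shows "a - a \<in> J"
    and "a - b \<in> J \<Longrightarrow> b - a \<in> J"
    and "a - b \<in> J \<Longrightarrow> b - c \<in> J \<Longrightarrow> a - c \<in> J"
    and "a - b \<in> J \<Longrightarrow> c - d \<in> J \<Longrightarrow> (a + c) - (b + d) \<in> J"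
    and "a - b \<in> J \<Longrightarrow> c - d \<in> J \<Longrightarrow> (a - c) - (b - d) \<in> J"
    and "a - b \<in> J \<Longrightarrow> - a - (- b) \<in> J"
    and "a - b \<in> J \<Longrightarrow> c - d \<in> J \<Longrightarrow> a * c - b * d \<in> J"
proof -
  have add: "a + b \<in> J" if "a \<in> J" "b \<in> J" for a b
    using assms that by (simp add: is_ideal_iff)
  have scale: "c * a \<in> J" if "a \<in> J" for a c
    using assms that by (simp add: is_ideal_iff)
  show "a - a \<in> J" using assms by (simp add: is_ideal_iff)
  show "a - b \<in> J \<Longrightarrow> b - a \<in> J" using scale[of "a - b" "-1"] by simp
  show "a - b \<in> J \<Longrightarrow> b - c \<in> J \<Longrightarrow> a - c \<in> J" using add[of "a - b" "b - c"] by simp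
  show "a - b \<in> J \<Longrightarrow> c - d \<in> J \<Longrightarrow> (a + c) - (b + d) \<in> J"
    using add[of "a - b" "c - d"] by (simp add: algebra_simps)
  show "a - b \<in> J \<Longrightarrow> c - d \<in> J \<Longrightarrow> (a - c) - (b - d) \<in> J"
    using add[of "a - b" "-1 * (c - d)"] scale[of "c - d" "-1"] by (simp add: algebra_simps)
  show "a - b \<in> J \<Longrightarrow> - a - (- b) \<in> J" using scale[of "a - b" "-1"] by simp
  show "a - b \<in> J \<Longrightarrow> c - d \<in> J \<Longrightarrow> a * c - b * d \<in> J"
    using add[of "c * (a - b)" "b * (c - d)"] scale[of "a - b" c] scale[of "c - d" b]
    by (simp add: algebra_simps)
qed

lemma ideal_equivp:
  fixes J :: "'a::comm_ring_1 set"
  assumes "is_ideal J"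
  shows "equivp (\<lambda>a b. a - b \<in> J)"
  by (intro equivpI reflpI sympI transpI) (fact ideal_quotient_simps[OF assms])+

lemma mpoly_induct [case_names single add]:
  fixes p :: "('i, 'r::comm_ring_1) mpoly"
  assumes "\<And>m c. P (Poly_Mapping.single m c)" "\<And>p q. P p \<Longrightarrow> P q \<Longrightarrow> P (p + q)"
  shows "P p"
proof -
  have eq: "p = (\<Sum>m\<in>Poly_Mapping.keys p. Poly_Mapping.single m (Poly_Mapping.lookup p m))"
    by (rule poly_mapping_eqI)
      (auto simp: lookup_sum lookup_single when_def in_keys_iff)
  have "finite S \<Longrightarrow> P (\<Sum>m\<in>S. Poly_Mapping.single m (Poly_Mapping.lookup p m))" for S
  proof (induction S rule: finite_induct)
    case empty
    then show ?case using assms(1)[of 0 0] by simp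
  next
    case (insert x F)
    then show ?case using assms by simp
  qed
  then show ?thesis using eq by (metis finite_keys)
qed

lemma sum_keys_add:
  fixes p q :: "('i, 'r::comm_ring_1) mpoly"
  assumes "\<And>m. g m 0 = 0" "\<And>m a b. g m (a + b) = g m a + g m b"
  shows "(\<Sum>m\<in>Poly_Mapping.keys (p + q). g m (Poly_Mapping.lookup (p + q) m)) =
    (\<Sum>m\<in>Poly_Mapping.keys p. g m (Poly_Mapping.lookup p m)) +
    (\<Sum>m\<in>Poly_Mapping.keys q. g m (Poly_Mapping.lookup q m))"
  by (rule setsum_keys_plus_distrib) (use assms in auto)

definition monom_eval :: "('i \<Rightarrow> 's::comm_ring_1) \<Rightarrow> ('i \<Rightarrow>\<^sub>0 nat) \<Rightarrow> 's"
  where "monom_eval x m = (\<Prod>i\<in>Poly_Mapping.keys m. x i ^ Poly_Mapping.lookup m i)"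

lemma monom_eval_superset:
  assumes "finite S" "Poly_Mapping.keys m \<subseteq> S"
  shows "monom_eval x m = (\<Prod>i\<in>S. x i ^ Poly_Mapping.lookup m i)"
  unfolding monom_eval_def
  by (rule prod.mono_neutral_left) (use assms in \<open>auto simp: in_keys_iff\<close>)

lemma monom_eval_add: "monom_eval x (m + n) = monom_eval x m * monom_eval x n"
proof -
  let ?S = "Poly_Mapping.keys m \<union> Poly_Mapping.keys n"
  have "Poly_Mapping.keys (m + n) \<subseteq> ?S" by (rule keys_add)
  then show ?thesis
    by (subst (1 2 3) monom_eval_superset[of ?S])
      (auto simp: lookup_add power_add prod.distrib)
qed

lemma monom_eval_simps [simp]:
  "monom_eval x 0 = 1" "monom_eval x (Poly_Mapping.single i n) = x i ^ n"
  by (cases "n = 0") (auto simp: monom_eval_def)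

context comm_ring_morphism
begin

lemma meval_single: "meval f x (Poly_Mapping.single m c) = f c * monom_eval x m"
  by (auto simp: meval_def monom_eval_def hom_zero)

lemma meval_add: "meval f x (p + q) = meval f x p + meval f x q"
  unfolding meval_def by (rule sum_keys_add) (auto simp: hom_zero hom_add algebra_simps)

lemma meval_mult: "meval f x (p * q) = meval f x p * meval f x q"
proof (induction p rule: mpoly_induct)
  case (single m c)
  show ?case
  proof (induction q rule: mpoly_induct)
    case (single m c)
    then show ?case by (simp add: mult_single meval_single monom_eval_add hom_mult)
  qed (simp add: distrib_left meval_add)
qed (simp add: distrib_right meval_add)

lemma meval_morphism: "comm_ring_morphism (meval f x)"
proof
  show "meval f x 1 = 1"
    using meval_single[of x 0 1] by (simp add: hom_one)
qed (simp_all add: meval_add meval_mult)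

lemma meval_mvar [simp]: "meval f x (mvar i) = x i"
  by (simp add: mvar_def meval_single hom_one)

lemma meval_mconst [simp]: "meval f x (mconst c) = f c"
  by (simp add: mconst_def meval_single)

end

lemma mconst_morphism: "comm_ring_morphism mconst"
  by unfold_locales (simp_all add: mconst_def single_add mult_single)


section \<open>The Hopf algebra \<open>k[G]\<close> of \<open>GL\<^sub>2\<close>\<close>

text \<open>\<open>Dinv\<close> is the variable \<open>y\<close> in the presentation \<open>k[x\<^sub>i\<^sub>j, y]/(y D - 1)\<close> of \<open>k[x\<^sub>i\<^sub>j, 1/D]\<close>.
  The two elements of the index type are \<open>1\<close> and \<open>2\<close>.\<close>

datatype gl2_var = X "2" "2" | Dinv

definition detD :: "(gl2_var \<Rightarrow> 'a::comm_ring_1) \<Rightarrow> 'a"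
  where "detD x = x (X 1 1) * x (X 2 2) - x (X 1 2) * x (X 2 1)"

definition gl2_ideal :: "(gl2_var, 'k::comm_ring_1) mpoly set"
  where "gl2_ideal = ideal_of {mvar Dinv * detD mvar - 1}"

lemma gl2_ideal_is_ideal: "is_ideal gl2_ideal"
  by (simp add: gl2_ideal_def is_ideal_ideal_of)

quotient_type (overloaded) 'k gl2_ring = "(gl2_var, 'k::field) mpoly" / "\<lambda>p q. p - q \<in> gl2_ideal"
  by (rule ideal_equivp[OF gl2_ideal_is_ideal])

lemma (in comm_ring_morphism) gl2_ideal_kernel:
  assumes "p \<in> gl2_ideal" "x Dinv * detD x = 1"
  shows "meval f x p = 0"
proof -
  interpret m: comm_ring_morphism "meval f x" by (rule meval_morphism)
  have "meval f x p \<in> {0}"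
    using assms(1) unfolding gl2_ideal_def
    by (rule m.hom_ideal_of)
      (use assms(2) in \<open>auto simp: detD_def m.hom_diff m.hom_mult m.hom_one is_ideal_iff\<close>)
  then show ?thesis by simp
qed

lemma id_morphism: "comm_ring_morphism (\<lambda>c. c)"
  by unfold_locales auto

text \<open>The identity matrix, as a point of \<open>GL\<^sub>2\<close>.\<close>

definition unit_point :: "gl2_var \<Rightarrow> 'k::field"
  where "unit_point v = (case v of X i j \<Rightarrow> if i = j then 1 else 0 | Dinv \<Rightarrow> 1)"

lemma two_neq_one [simp]: "(2::2) \<noteq> 1" "(1::2) \<noteq> 2"
  by auto

lemma unit_point_det: "unit_point Dinv * detD unit_point = (1::'k::field)"
  by (simp add: unit_point_def detD_def)

lift_definition counit_G :: "'k::field gl2_ring \<Rightarrow> 'k" is "meval (\<lambda>c. c) unit_point"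
proof -
  fix p q :: "(gl2_var, 'k) mpoly"
  interpret c: comm_ring_morphism "\<lambda>c::'k. c" by (rule id_morphism)
  interpret m: comm_ring_morphism "meval (\<lambda>c. c) (unit_point :: gl2_var \<Rightarrow> 'k)" by (rule c.meval_morphism)
  assume "p - q \<in> gl2_ideal"
  then show "meval (\<lambda>c. c) unit_point p = meval (\<lambda>c. c) unit_point q"
    using c.gl2_ideal_kernel[OF _ unit_point_det] m.hom_diff[of p q] by simp
qed

lemma abs_gl2_ring_surj: "\<exists>p. a = abs_gl2_ring p"
  by (induct a rule: gl2_ring.abs_induct) blast

instantiation gl2_ring :: (field) comm_ring_1
begin
lift_definition zero_gl2_ring :: "'a gl2_ring" is 0 .
lift_definition one_gl2_ring :: "'a gl2_ring" is 1 .
lift_definition plus_gl2_ring :: "'a gl2_ring \<Rightarrow> 'a gl2_ring \<Rightarrow> 'a gl2_ring" is "(+)"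
  by (erule (1) ideal_quotient_simps(4)[OF gl2_ideal_is_ideal])
lift_definition minus_gl2_ring :: "'a gl2_ring \<Rightarrow> 'a gl2_ring \<Rightarrow> 'a gl2_ring" is "(-)"
  by (erule (1) ideal_quotient_simps(5)[OF gl2_ideal_is_ideal])
lift_definition uminus_gl2_ring :: "'a gl2_ring \<Rightarrow> 'a gl2_ring" is "uminus"
  by (erule ideal_quotient_simps(6)[OF gl2_ideal_is_ideal])
lift_definition times_gl2_ring :: "'a gl2_ring \<Rightarrow> 'a gl2_ring \<Rightarrow> 'a gl2_ring" is "(*)"
  by (erule (1) ideal_quotient_simps(7)[OF gl2_ideal_is_ideal])
instance
proof
  fix a b c :: "'a gl2_ring"
  obtain p where p: "a = abs_gl2_ring p" using abs_gl2_ring_surj ..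
  obtain q where q: "b = abs_gl2_ring q" using abs_gl2_ring_surj ..
  obtain r where r: "c = abs_gl2_ring r" using abs_gl2_ring_surj ..
  note abs = p q r zero_gl2_ring_def one_gl2_ring_def plus_gl2_ring.abs_eq minus_gl2_ring.abs_eq
    uminus_gl2_ring.abs_eq times_gl2_ring.abs_eq
  show "a + b + c = a + (b + c)" unfolding abs by (simp add: algebra_simps)
  show "a + b = b + a" unfolding abs by (simp add: algebra_simps)
  show "0 + a = a" unfolding abs by simp
  show "- a + a = 0" unfolding abs by simp
  show "a - b = a + - b" unfolding abs by (simp only: diff_conv_add_uminus)
  show "a * b * c = a * (b * c)" unfolding abs by (simp only: mult.assoc)
  show "a * b = b * a" unfolding abs by (simp only: mult.commute)
  show "1 * a = a" unfolding abs by (simp only: mult_1_left)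
  show "(a + b) * c = a * c + b * c" unfolding abs by (simp only: distrib_right)
  have "counit_G (0::'a gl2_ring) = 0"
    by (simp add: zero_gl2_ring_def counit_G.abs_eq meval_def)
  moreover have "counit_G (1::'a gl2_ring) = 1"
    unfolding one_gl2_ring_def counit_G.abs_eq
    by (rule comm_ring_morphism.hom_one[OF comm_ring_morphism.meval_morphism[OF id_morphism]])
  ultimately show "(0::'a gl2_ring) \<noteq> 1" by auto
qed
end

lift_definition const_G :: "'k::field \<Rightarrow> 'k gl2_ring" is mconst .
lift_definition coord_G :: "gl2_var \<Rightarrow> 'k::field gl2_ring" is mvar .

definition scale_G :: "'k::field \<Rightarrow> 'k gl2_ring \<Rightarrow> 'k gl2_ring"
  where "scale_G c a = const_G c * a"

lemma abs_G_morphism: "comm_ring_morphism (abs_gl2_ring :: (gl2_var, 'k::field) mpoly \<Rightarrow> _)"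
  by (rule comm_ring_morphism.intro)
    (simp_all only: one_gl2_ring.abs_eq plus_gl2_ring.abs_eq times_gl2_ring.abs_eq)

lemma morphism_comp:
  "comm_ring_morphism f \<Longrightarrow> comm_ring_morphism g \<Longrightarrow> comm_ring_morphism (\<lambda>a. g (f a))"
  by (simp add: comm_ring_morphism_def)

lemma morphism_prod:
  assumes "comm_ring_morphism f"
  shows "f (\<Prod>i\<in>S. h i) = (\<Prod>i\<in>S. f (h i))"
proof -
  interpret comm_ring_morphism f by fact
  show ?thesis by (induction S rule: infinite_finite_induct) (auto simp: hom_one hom_mult)
qed

lemma morphism_power:
  assumes "comm_ring_morphism f"
  shows "f (a ^ n) = f a ^ n"
proof -
  interpret comm_ring_morphism f by fact
  show ?thesis by (induction n) (auto simp: hom_one hom_mult)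
qed

lemma mvar_power: "mvar i ^ n = (Poly_Mapping.single (Poly_Mapping.single i n) 1 :: ('i, 'r::comm_ring_1) mpoly)"
  by (induction n) (auto simp: mvar_def mult_single single_add[symmetric])

lemma single_eq_monom_eval:
  "(Poly_Mapping.single m c :: ('i, 'r::comm_ring_1) mpoly) = mconst c * monom_eval mvar m"
proof -
  have eq: "m = (\<Sum>i\<in>Poly_Mapping.keys m. Poly_Mapping.single i (Poly_Mapping.lookup m i))"
    by (rule poly_mapping_eqI) (auto simp: lookup_sum lookup_single when_def in_keys_iff)
  have *: "(\<Prod>i\<in>S. mvar i ^ h i) =
    (Poly_Mapping.single (\<Sum>i\<in>S. Poly_Mapping.single i (h i)) 1 :: ('i, 'r) mpoly)" for S h
    by (induction S rule: infinite_finite_induct) (auto simp: mvar_power mult_single)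
  have "monom_eval mvar m = (Poly_Mapping.single m 1 :: ('i, 'r) mpoly)"
    unfolding monom_eval_def * using eq by simp
  then show ?thesis by (simp add: mconst_def mult_single)
qed

lemma morphism_eqI:
  fixes f g :: "('i, 'r::comm_ring_1) mpoly \<Rightarrow> 's::comm_ring_1"
  assumes f: "comm_ring_morphism f" and g: "comm_ring_morphism g"
    and "\<And>c. f (mconst c) = g (mconst c)" "\<And>i. f (mvar i) = g (mvar i)"
  shows "f p = g p"
proof (induction p rule: mpoly_induct)
  case (single m c)
  interpret f: comm_ring_morphism f by fact
  interpret g: comm_ring_morphism g by fact
  show ?case
    by (simp add: single_eq_monom_eval f.hom_mult g.hom_mult monom_eval_def
        morphism_prod[OF f] morphism_prod[OF g] morphism_power[OF f] morphism_power[OF g] assms)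
next
  case (add p q)
  then show ?case using f g by (simp add: comm_ring_morphism_def)
qed

text \<open>For a commutative algebra \<open>A\<close> with structure map \<open>\<phi>\<close> and a matrix with entries in \<open>A\<close>, given
  as an assignment \<open>x\<close>, this is the homomorphism \<open>x\<^sub>i\<^sub>j \<mapsto> \<Sum>\<^sub>l x\<^sub>i\<^sub>l x'\<^sub>l\<^sub>j\<close> into the polynomial ring over
  \<open>A\<close> in the variables \<open>x'\<close>.  As \<open>D\<close> is group-like, so is \<open>1/D\<close>.\<close>

definition comult_poly ::
  "('k \<Rightarrow> 'a) \<Rightarrow> (gl2_var \<Rightarrow> 'a) \<Rightarrow> (gl2_var, 'k::field) mpoly \<Rightarrow> (gl2_var, 'a::comm_ring_1) mpoly"
  where "comult_poly \<phi> x = meval (\<lambda>c. mconst (\<phi> c))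
    (\<lambda>v. case v of X i j \<Rightarrow> \<Sum>l\<in>UNIV. mconst (x (X i l)) * mvar (X l j)
      | Dinv \<Rightarrow> mconst (x Dinv) * mvar Dinv)"

lemma UNIV_index: "(UNIV :: 2 set) = {1, 2}"
  by (rule card_subset_eq[symmetric]) simp_all

lemma mscale_vector_space: "vector_space (mscale :: 'k::field \<Rightarrow> ('i, 'k) mpoly \<Rightarrow> _)"
proof -
  interpret c: comm_ring_morphism "mconst :: 'k \<Rightarrow> ('i, 'k) mpoly" by (rule mconst_morphism)
  show ?thesis
    by unfold_locales (auto simp: mscale_def c.hom_one c.hom_add c.hom_mult algebra_simps)
qed

lemma det_mult: "e * E * ((a * A + b * C) * (c * B + d * D) - (a * B + b * D) * (c * A + d * C)) =
    (e * (a * d - b * c)) * (E * (A * D - B * C))" for e :: "'a::comm_ring_1"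
  by (simp add: algebra_simps)

locale gl2_point =
  fixes \<phi> :: "'k::field \<Rightarrow> 'a::comm_ring_1" and \<pi> :: "(gl2_var, 'k) mpoly \<Rightarrow> 'a"
    and sA :: "'k \<Rightarrow> 'a \<Rightarrow> 'a"
  assumes \<phi>: "comm_ring_morphism \<phi>" and \<pi>: "comm_ring_morphism \<pi>"
    and \<pi>_mconst: "\<pi> (mconst c) = \<phi> c" and sA: "sA c a = \<phi> c * a"
    and \<pi>_det: "\<pi> (mvar Dinv * detD mvar) = 1"
begin

sublocale \<phi>: comm_ring_morphism \<phi> by (rule \<phi>)
sublocale \<pi>: comm_ring_morphism \<pi> by (rule \<pi>)

lemma sA_vector_space: "vector_space sA"
  by unfold_locales (auto simp: sA \<phi>.hom_one \<phi>.hom_add \<phi>.hom_mult algebra_simps)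

lemma \<pi>_linear: "Vector_Spaces.linear mscale sA \<pi>"
  using mscale_vector_space sA_vector_space
  by (auto simp: Vector_Spaces.linear_iff sA \<pi>.hom_add \<pi>.hom_mult \<pi>_mconst mscale_def)

lemma id_linear: "Vector_Spaces.linear sA sA id"
  using sA_vector_space by (auto simp: Vector_Spaces.linear_iff)

definition quot_tensor :: "(gl2_var, 'a) mpoly \<Rightarrow> ('k, 'a, 'a) tensor"
  where "quot_tensor q = tensor_map sA sA id \<pi> (mpoly_tensor sA q)"

lemma quot_tensor_single: "quot_tensor (Poly_Mapping.single m a) = tensor sA sA a (\<pi> (Poly_Mapping.single m 1))"
proof (cases "a = 0")
  case True
  have "tensor_map sA sA id \<pi> 0 = (0 :: ('k, 'a, 'a) tensor)"
    by (auto simp: tensor_map_def fun_eq_iff)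
  with True show ?thesis
    by (simp add: quot_tensor_def mpoly_tensor_def tensor_simps[OF sA_vector_space sA_vector_space])
next
  case False
  then have "mpoly_tensor sA (Poly_Mapping.single m a) = tensor sA mscale a (Poly_Mapping.single m 1)"
    by (simp add: mpoly_tensor_def)
  then show ?thesis
    by (simp only: quot_tensor_def tensor_map_tensor[OF id_linear \<pi>_linear] id_apply)
qed

lemma quot_tensor_add: "quot_tensor (p + q) = quot_tensor p + quot_tensor q"
proof -
  have "mpoly_tensor sA (p + q) = mpoly_tensor sA p + mpoly_tensor sA q"
    unfolding mpoly_tensor_def
    by (rule sum_keys_add) (rule tensor_simps[OF sA_vector_space mscale_vector_space])+
  then show ?thesis by (auto simp: quot_tensor_def tensor_map_def fun_eq_iff)
qed

text \<open>Multiplying by a polynomial \<open>u\<close> in the second factor.\<close>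

lemma quot_tensor_right:
  "quot_tensor (Poly_Mapping.single m a * meval (\<lambda>c. mconst (\<phi> c)) mvar u) =
    tensor sA sA a (\<pi> (Poly_Mapping.single m 1 * u))"
proof (induction u rule: mpoly_induct)
  case (single n c)
  interpret c: comm_ring_morphism "\<lambda>c. mconst (\<phi> c) :: (gl2_var, 'a) mpoly"
    by (rule morphism_comp[OF \<phi> mconst_morphism])
  have "\<pi> (Poly_Mapping.single (m + n) c) = sA c (\<pi> (Poly_Mapping.single (m + n) 1))"
    by (simp add: sA \<pi>_mconst[symmetric] \<pi>.hom_mult[symmetric]) (simp add: mconst_def mult_single)
  moreover have "meval (\<lambda>c. mconst (\<phi> c)) mvar (Poly_Mapping.single n c) =
    (Poly_Mapping.single n (\<phi> c) :: (gl2_var, 'a) mpoly)"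
    using c.meval_single[of mvar n c] by (simp add: single_eq_monom_eval[symmetric])
  ultimately show ?case
    by (simp only: mult_single quot_tensor_single mult.commute[of a "\<phi> c"] sA[symmetric] mult_1_left
        tensor_simps[OF sA_vector_space sA_vector_space])
next
  case (add p q)
  interpret c: comm_ring_morphism "\<lambda>c. mconst (\<phi> c) :: (gl2_var, 'a) mpoly"
    by (rule morphism_comp[OF \<phi> mconst_morphism])
  show ?case
    by (simp add: add c.meval_add distrib_left quot_tensor_add \<pi>.hom_add
        tensor_simps[OF sA_vector_space sA_vector_space])
qed

text \<open>An ideal contained in the kernel of \<^term>\<open>quot_tensor\<close>.\<close>

definition quot_kernel :: "(gl2_var, 'a) mpoly set"
  where "quot_kernel = {q. \<forall>s. quot_tensor (s * q) = 0}"

lemma quot_kernel_zero: "q \<in> quot_kernel \<Longrightarrow> quot_tensor q = 0"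
  unfolding quot_kernel_def by (auto dest: spec[of _ 1])

lemma quot_kernel_is_ideal: "is_ideal quot_kernel"
  unfolding is_ideal_iff
proof (intro conjI)
  have "quot_tensor 0 = 0" by (auto simp: quot_tensor_def mpoly_tensor_def tensor_map_def fun_eq_iff)
  then show "0 \<in> quot_kernel" by (simp add: quot_kernel_def)
qed (auto simp: quot_kernel_def distrib_left quot_tensor_add mult.assoc[symmetric])

lemma quot_kernelI:
  assumes "\<pi> u = 0"
  shows "meval (\<lambda>c. mconst (\<phi> c)) mvar u \<in> quot_kernel"
  unfolding quot_kernel_def
proof (intro CollectI allI)
  fix s
  show "quot_tensor (s * meval (\<lambda>c. mconst (\<phi> c)) mvar u) = 0"
  proof (induction s rule: mpoly_induct)
    case (single m c)
    then show ?case
      by (simp only: quot_tensor_right \<pi>.hom_mult assms mult_zero_right tensor_simps[OF sA_vector_space sA_vector_space])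
  qed (simp add: distrib_right quot_tensor_add)
qed

abbreviation "\<delta> \<equiv> comult_poly \<phi> (\<lambda>v. \<pi> (mvar v))"

lemma comult_poly_morphism: "comm_ring_morphism \<delta>"
  unfolding comult_poly_def
  by (rule comm_ring_morphism.meval_morphism[OF morphism_comp[OF \<phi> mconst_morphism]])

lemma comult_poly_simps:
  "\<delta> (mvar (X i j)) = mconst (\<pi> (mvar (X i 1))) * mvar (X 1 j) + mconst (\<pi> (mvar (X i 2))) * mvar (X 2 j)"
  "\<delta> (mvar Dinv) = mconst (\<pi> (mvar Dinv)) * mvar Dinv"
  "\<delta> (mconst c) = mconst (\<phi> c)"
  by (simp_all add: comult_poly_def UNIV_index
      comm_ring_morphism.meval_mvar[OF morphism_comp[OF \<phi> mconst_morphism]]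
      comm_ring_morphism.meval_mconst[OF morphism_comp[OF \<phi> mconst_morphism]])

lemma comult_poly_gl2_ideal:
  assumes "p \<in> gl2_ideal"
  shows "\<delta> p \<in> quot_kernel"
proof -
  interpret d: comm_ring_morphism \<delta> by (rule comult_poly_morphism)
  interpret c: comm_ring_morphism "mconst :: 'a \<Rightarrow> (gl2_var, 'a) mpoly" by (rule mconst_morphism)
  interpret m: comm_ring_morphism "meval (\<lambda>c. mconst (\<phi> c)) (mvar :: gl2_var \<Rightarrow> (gl2_var, 'a) mpoly)"
    by (rule comm_ring_morphism.meval_morphism[OF morphism_comp[OF \<phi> mconst_morphism]])
  let ?u = "mvar Dinv * detD mvar - 1 :: (gl2_var, 'k) mpoly"
  have mv: "meval (\<lambda>c. mconst (\<phi> c)) mvar (mvar v) = (mvar v :: (gl2_var, 'a) mpoly)" for v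
    by (rule comm_ring_morphism.meval_mvar[OF morphism_comp[OF \<phi> mconst_morphism]])
  have det1: "mconst (\<pi> (mvar Dinv)) * (mconst (\<pi> (mvar (X 1 1))) * mconst (\<pi> (mvar (X 2 2))) -
      mconst (\<pi> (mvar (X 1 2))) * mconst (\<pi> (mvar (X 2 1)))) = (1 :: (gl2_var, 'a) mpoly)"
    using arg_cong[OF \<pi>_det, of "mconst :: 'a \<Rightarrow> (gl2_var, 'a) mpoly"]
    by (simp add: detD_def \<pi>.hom_mult \<pi>.hom_diff c.hom_mult c.hom_diff c.hom_one)
  have "\<delta> ?u = meval (\<lambda>c. mconst (\<phi> c)) mvar ?u"
    unfolding detD_def d.hom_diff d.hom_mult d.hom_one m.hom_diff m.hom_mult m.hom_one mv
      comult_poly_simps det_mult det1 by (simp only: mult_1_left)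
  moreover have "\<pi> ?u = 0" by (simp add: \<pi>.hom_diff \<pi>_det \<pi>.hom_one)
  ultimately have "\<delta> ?u \<in> quot_kernel" using quot_kernelI by metis
  then show ?thesis
    using d.hom_ideal_of[OF assms[unfolded gl2_ideal_def] _ quot_kernel_is_ideal] by blast
qed

end

lemma gl2_point_G: "gl2_point (const_G :: 'k::field \<Rightarrow> _) abs_gl2_ring scale_G"
proof -
  interpret \<pi>: comm_ring_morphism "abs_gl2_ring :: (gl2_var, 'k) mpoly \<Rightarrow> _" by (rule abs_G_morphism)
  show ?thesis
  proof
    show "abs_gl2_ring (mvar Dinv * detD mvar) = (1 :: 'k gl2_ring)"
      unfolding one_gl2_ring_def gl2_ring.abs_eq_iff gl2_ideal_def by (simp add: ideal_of_base)
    fix a b :: 'k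
    show "const_G 1 = (1 :: 'k gl2_ring)" "const_G (a + b) = const_G a + const_G b"
      "const_G (a * b) = const_G a * const_G b"
      using mconst_morphism[where ?'a = 'k and ?'b = gl2_var]
      by (simp_all add: comm_ring_morphism_def const_G.abs_eq \<pi>.hom_one \<pi>.hom_add \<pi>.hom_mult)
  qed (simp_all add: \<pi>.hom_one \<pi>.hom_add \<pi>.hom_mult const_G.abs_eq scale_G_def)
qed

lift_definition comult_G :: "'k::field gl2_ring \<Rightarrow> ('k, 'k gl2_ring, 'k gl2_ring) tensor"
  is "\<lambda>p. tensor_map scale_G scale_G id abs_gl2_ring
    (mpoly_tensor scale_G (comult_poly const_G coord_G p))"
proof -
  fix p q :: "(gl2_var, 'k) mpoly"
  interpret gl2_point "const_G :: 'k \<Rightarrow> _" abs_gl2_ring scale_G by (rule gl2_point_G)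
  interpret d: comm_ring_morphism \<delta> by (rule comult_poly_morphism)
  have co: "(coord_G :: gl2_var \<Rightarrow> 'k gl2_ring) = (\<lambda>v. abs_gl2_ring (mvar v))"
    by (simp add: coord_G.abs_eq fun_eq_iff)
  assume "p - q \<in> gl2_ideal"
  then have "quot_tensor (\<delta> (p - q)) = 0"
    by (intro quot_kernel_zero comult_poly_gl2_ideal)
  then have "quot_tensor (\<delta> (q + (p - q))) = quot_tensor (\<delta> q)"
    unfolding d.hom_add quot_tensor_add by simp
  then show "?thesis p q" unfolding co quot_tensor_def by simp
qed


section \<open>The quotient \<open>k[N] = k[G]/I\<^sub>1I\<^sub>2\<close>\<close>

definition ideal_I1 :: "'k::field gl2_ring set"
  where "ideal_I1 = ideal_of {coord_G (X 1 2), coord_G (X 2 1)}"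

definition ideal_I2 :: "'k::field gl2_ring set"
  where "ideal_I2 = ideal_of {coord_G (X 1 1), coord_G (X 2 2)}"

lemma is_ideal_ideal_prod: "is_ideal (ideal_prod I J)"
  by (simp add: ideal_prod_def is_ideal_ideal_of)

lemma ideal_prod_minimal:
  assumes "is_ideal H" "\<And>s t. s \<in> S \<Longrightarrow> t \<in> T \<Longrightarrow> s * t \<in> H"
  shows "ideal_prod (ideal_of S) (ideal_of T) \<subseteq> H"
proof -
  have H: "0 \<in> H" "\<And>a b. a \<in> H \<Longrightarrow> b \<in> H \<Longrightarrow> a + b \<in> H" "\<And>c a. a \<in> H \<Longrightarrow> c * a \<in> H"
    using assms(1) by (auto simp: is_ideal_iff)
  have "is_ideal {b. s * b \<in> H}" for s
    using H by (auto simp: is_ideal_iff distrib_left mult.left_commute)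
  then have 1: "s * b \<in> H" if "s \<in> S" "b \<in> ideal_of T" for s b
    using ideal_of_minimal[of T "{b. s * b \<in> H}"] assms(2) that by blast
  have "is_ideal {a. a * b \<in> H}" for b
    using H by (auto simp: is_ideal_iff distrib_right mult.assoc)
  then have "a * b \<in> H" if "a \<in> ideal_of S" "b \<in> ideal_of T" for a b
    using ideal_of_minimal[of S "{a. a * b \<in> H}"] 1 that by blast
  then show ?thesis
    unfolding ideal_prod_def by (intro ideal_of_minimal assms(1)) auto
qed

quotient_type (overloaded) 'k nrm_ring = "'k::field gl2_ring" /
  "\<lambda>a b. a - b \<in> ideal_prod ideal_I1 ideal_I2"
  by (rule ideal_equivp[OF is_ideal_ideal_prod])

lemma counit_G_abs: "counit_G (abs_gl2_ring p) = meval (\<lambda>c. c) unit_point p"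
  by (rule counit_G.abs_eq)

lemma counit_G_morphism: "comm_ring_morphism (counit_G :: 'k::field gl2_ring \<Rightarrow> 'k)"
proof -
  interpret c: comm_ring_morphism "\<lambda>c::'k. c" by (rule id_morphism)
  interpret m: comm_ring_morphism "meval (\<lambda>c. c) (unit_point :: gl2_var \<Rightarrow> 'k)" by (rule c.meval_morphism)
  show ?thesis
  proof
    show "counit_G 1 = (1 :: 'k)"
      unfolding one_gl2_ring_def counit_G_abs by (rule m.hom_one)
    fix a b :: "'k gl2_ring"
    obtain p where p: "a = abs_gl2_ring p" using abs_gl2_ring_surj ..
    obtain q where q: "b = abs_gl2_ring q" using abs_gl2_ring_surj ..
    show "counit_G (a + b) = counit_G a + counit_G b"
      unfolding p q plus_gl2_ring.abs_eq counit_G_abs by (rule m.hom_add)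
    show "counit_G (a * b) = counit_G a * counit_G b"
      unfolding p q times_gl2_ring.abs_eq counit_G_abs by (rule m.hom_mult)
  qed
qed

lift_definition counit_N :: "'k::field nrm_ring \<Rightarrow> 'k" is counit_G
proof -
  fix a b :: "'k gl2_ring"
  interpret e: comm_ring_morphism "counit_G :: 'k gl2_ring \<Rightarrow> 'k" by (rule counit_G_morphism)
  interpret c: comm_ring_morphism "\<lambda>c::'k. c" by (rule id_morphism)
  have "counit_G (coord_G (X i j)) = (0::'k)" if "i \<noteq> j" for i j
    using that by (simp add: coord_G.abs_eq counit_G_abs unit_point_def)
  then have "ideal_prod ideal_I1 ideal_I2 \<subseteq> {a. counit_G a = (0::'k)}"
    unfolding ideal_I1_def ideal_I2_def
    by (intro ideal_prod_minimal) (auto simp: is_ideal_iff e.hom_zero e.hom_add e.hom_mult)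
  moreover assume "a - b \<in> ideal_prod ideal_I1 ideal_I2"
  ultimately show "counit_G a = counit_G b" using e.hom_diff[of a b] by auto
qed

lemma abs_nrm_ring_surj: "\<exists>p. a = abs_nrm_ring p"
  by (induct a rule: nrm_ring.abs_induct) blast

instantiation nrm_ring :: (field) comm_ring_1
begin
lift_definition zero_nrm_ring :: "'a nrm_ring" is 0 .
lift_definition one_nrm_ring :: "'a nrm_ring" is 1 .
lift_definition plus_nrm_ring :: "'a nrm_ring \<Rightarrow> 'a nrm_ring \<Rightarrow> 'a nrm_ring" is "(+)"
  by (erule (1) ideal_quotient_simps(4)[OF is_ideal_ideal_prod])
lift_definition minus_nrm_ring :: "'a nrm_ring \<Rightarrow> 'a nrm_ring \<Rightarrow> 'a nrm_ring" is "(-)"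
  by (erule (1) ideal_quotient_simps(5)[OF is_ideal_ideal_prod])
lift_definition uminus_nrm_ring :: "'a nrm_ring \<Rightarrow> 'a nrm_ring" is "uminus"
  by (erule ideal_quotient_simps(6)[OF is_ideal_ideal_prod])
lift_definition times_nrm_ring :: "'a nrm_ring \<Rightarrow> 'a nrm_ring \<Rightarrow> 'a nrm_ring" is "(*)"
  by (erule (1) ideal_quotient_simps(7)[OF is_ideal_ideal_prod])
instance
proof
  fix a b c :: "'a nrm_ring"
  obtain p where p: "a = abs_nrm_ring p" using abs_nrm_ring_surj ..
  obtain q where q: "b = abs_nrm_ring q" using abs_nrm_ring_surj ..
  obtain r where r: "c = abs_nrm_ring r" using abs_nrm_ring_surj ..
  note abs = p q r zero_nrm_ring_def one_nrm_ring_def plus_nrm_ring.abs_eq minus_nrm_ring.abs_eq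
    uminus_nrm_ring.abs_eq times_nrm_ring.abs_eq
  show "a + b + c = a + (b + c)" unfolding abs by (simp only: add.assoc)
  show "a + b = b + a" unfolding abs by (simp only: add.commute)
  show "0 + a = a" unfolding abs by simp
  show "- a + a = 0" unfolding abs by simp
  show "a - b = a + - b" unfolding abs by simp
  show "a * b * c = a * (b * c)" unfolding abs by (simp only: mult.assoc)
  show "a * b = b * a" unfolding abs by (simp only: mult.commute)
  show "1 * a = a" unfolding abs by simp
  show "(a + b) * c = a * c + b * c" unfolding abs by (simp only: distrib_right)
  have "counit_N (0::'a nrm_ring) = 0"
    unfolding zero_nrm_ring_def counit_N.abs_eq
    by (rule comm_ring_morphism.hom_zero[OF counit_G_morphism])
  moreover have "counit_N (1::'a nrm_ring) = 1"
    unfolding one_nrm_ring_def counit_N.abs_eq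
    by (rule comm_ring_morphism.hom_one[OF counit_G_morphism])
  ultimately show "(0::'a nrm_ring) \<noteq> 1" by auto
qed
end

definition coord_N :: "gl2_var \<Rightarrow> 'k::field nrm_ring"
  where "coord_N v = abs_nrm_ring (coord_G v)"

definition scale_N :: "'k::field \<Rightarrow> 'k nrm_ring \<Rightarrow> 'k nrm_ring"
  where "scale_N c a = abs_nrm_ring (const_G c) * a"

lemma abs_N_morphism: "comm_ring_morphism (abs_nrm_ring :: 'k::field gl2_ring \<Rightarrow> _)"
  by (rule comm_ring_morphism.intro)
    (simp_all only: one_nrm_ring.abs_eq plus_nrm_ring.abs_eq times_nrm_ring.abs_eq)

lemma gl2_point_N:
  "gl2_point (\<lambda>c::'k::field. abs_nrm_ring (const_G c)) (\<lambda>p. abs_nrm_ring (abs_gl2_ring p)) scale_N"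
proof -
  interpret G: gl2_point "const_G :: 'k \<Rightarrow> _" abs_gl2_ring scale_G by (rule gl2_point_G)
  interpret n: comm_ring_morphism "abs_nrm_ring :: 'k gl2_ring \<Rightarrow> _" by (rule abs_N_morphism)
  show ?thesis
    by (rule gl2_point.intro)
      (simp_all only: morphism_comp[OF G.\<phi> abs_N_morphism] morphism_comp[OF G.\<pi> abs_N_morphism]
        G.\<pi>_mconst scale_N_def G.\<pi>_det n.hom_one)
qed

lemma abs_N_linear: "Vector_Spaces.linear scale_G scale_N (abs_nrm_ring :: 'k::field gl2_ring \<Rightarrow> _)"
proof -
  interpret G: gl2_point "const_G :: 'k \<Rightarrow> _" abs_gl2_ring scale_G by (rule gl2_point_G)
  interpret N: gl2_point "\<lambda>c::'k. abs_nrm_ring (const_G c)" "\<lambda>p. abs_nrm_ring (abs_gl2_ring p)" scale_N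
    by (rule gl2_point_N)
  interpret n: comm_ring_morphism "abs_nrm_ring :: 'k gl2_ring \<Rightarrow> _" by (rule abs_N_morphism)
  show ?thesis
    using G.sA_vector_space N.sA_vector_space
    by (simp add: Vector_Spaces.linear_iff n.hom_add n.hom_mult scale_G_def scale_N_def)
qed

lemma mpoly_tensor_single:
  assumes "vector_space sA"
  shows "mpoly_tensor sA (Poly_Mapping.single m a) = tensor sA mscale a (Poly_Mapping.single m 1)"
  by (cases "a = 0") (simp_all add: mpoly_tensor_def tensor_simps[OF assms mscale_vector_space])

lemma mpoly_tensor_add:
  assumes "vector_space sA"
  shows "mpoly_tensor sA (p + q) = mpoly_tensor sA p + mpoly_tensor sA q"
  unfolding mpoly_tensor_def
  by (rule sum_keys_add) (rule tensor_simps[OF assms mscale_vector_space])+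

text \<open>In \<open>k[N]\<close> the product of a diagonal and an off-diagonal coordinate vanishes.\<close>

lemma coord_N_mult_zero:
  assumes "i = j \<longleftrightarrow> l \<noteq> m"
  shows "coord_N (X i j) * coord_N (X l m) = (0 :: 'k::field nrm_ring)"
proof -
  have *: "coord_N (X i j) * coord_N (X l m) = (0 :: 'k nrm_ring)" if "i \<noteq> j" "l = m" for i j l m
  proof -
    have ex: "x = 1 \<or> x = 2" for x :: 2 using UNIV_index by auto
    have "coord_G (X i j) \<in> (ideal_I1 :: 'k gl2_ring set)"
      unfolding ideal_I1_def using that(1) ex[of i] ex[of j] by (intro ideal_of_base) auto
    moreover have "coord_G (X l m) \<in> (ideal_I2 :: 'k gl2_ring set)"
      unfolding ideal_I2_def using that(2) ex[of l] by (intro ideal_of_base) auto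
    ultimately have "coord_G (X i j) * coord_G (X l m) \<in> (ideal_prod ideal_I1 ideal_I2 :: 'k gl2_ring set)"
      unfolding ideal_prod_def by (intro ideal_of_base) blast
    then show ?thesis
      by (simp add: coord_N_def times_nrm_ring.abs_eq zero_nrm_ring_def nrm_ring.abs_eq_iff)
  qed
  show ?thesis
  proof (cases "i = j")
    case True
    then show ?thesis using assms *[of l m i j] by (simp add: mult.commute)
  qed (use assms * in auto)
qed

lemma meval_coeff_map:
  assumes "comm_ring_morphism f"
  shows "meval (\<lambda>a. mconst (f a)) mvar (Poly_Mapping.single m a) = Poly_Mapping.single m (f a)"
  using comm_ring_morphism.meval_single[OF morphism_comp[OF assms mconst_morphism], of mvar m a]
  by (simp add: single_eq_monom_eval)

lemma tensor_map_add: "tensor_map sC sD f g (S + T) = tensor_map sC sD f g S + tensor_map sC sD f g T"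
  by (auto simp: tensor_map_def fun_eq_iff)

lemma comult_G_quotient:
  "tensor_map scale_N scale_N abs_nrm_ring abs_nrm_ring (comult_G (abs_gl2_ring p)) =
    tensor_map scale_N scale_N id (\<lambda>p. abs_nrm_ring (abs_gl2_ring p)) (mpoly_tensor scale_N
      (comult_poly (\<lambda>c::'k::field. abs_nrm_ring (const_G c)) coord_N p))"
proof -
  interpret G: gl2_point "const_G :: 'k \<Rightarrow> _" abs_gl2_ring scale_G by (rule gl2_point_G)
  interpret N: gl2_point "\<lambda>c::'k. abs_nrm_ring (const_G c)" "\<lambda>p. abs_nrm_ring (abs_gl2_ring p)" scale_N
    by (rule gl2_point_N)
  interpret n: comm_ring_morphism "abs_nrm_ring :: 'k gl2_ring \<Rightarrow> _" by (rule abs_N_morphism)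
  have coN: "(coord_N :: gl2_var \<Rightarrow> 'k nrm_ring) = (\<lambda>v. abs_nrm_ring (abs_gl2_ring (mvar v)))"
    by (simp add: coord_N_def coord_G.abs_eq fun_eq_iff)
  have coG: "(coord_G :: gl2_var \<Rightarrow> 'k gl2_ring) = (\<lambda>v. abs_gl2_ring (mvar v))"
    by (simp add: coord_G.abs_eq fun_eq_iff)
  let ?M = "meval (\<lambda>a. mconst (abs_nrm_ring a)) mvar :: (gl2_var, 'k gl2_ring) mpoly \<Rightarrow> (gl2_var, 'k nrm_ring) mpoly"
  interpret mn: comm_ring_morphism "\<lambda>a. mconst (abs_nrm_ring a) :: (gl2_var, 'k nrm_ring) mpoly"
    by (rule morphism_comp[OF abs_N_morphism mconst_morphism])
  interpret M: comm_ring_morphism ?M by (rule mn.meval_morphism)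
  have 1: "tensor_map scale_N scale_N abs_nrm_ring abs_nrm_ring (G.quot_tensor q) = N.quot_tensor (?M q)" for q
  proof (induction q rule: mpoly_induct)
    case (single m a)
    show ?case
      unfolding G.quot_tensor_single meval_coeff_map[OF abs_N_morphism] N.quot_tensor_single
      by (rule tensor_map_tensor[OF abs_N_linear abs_N_linear])
  next
    case (add p q)
    then show ?case
      by (simp only: G.quot_tensor_add M.hom_add N.quot_tensor_add tensor_map_add)
  qed
  have 2: "?M (G.\<delta> p) = N.\<delta> p"
  proof (rule morphism_eqI[OF morphism_comp[OF G.comult_poly_morphism M.comm_ring_morphism_axioms]
        N.comult_poly_morphism])
    fix v show "?M (G.\<delta> (mvar v)) = N.\<delta> (mvar v)"
      by (cases v) (simp_all only: G.comult_poly_simps N.comult_poly_simps M.hom_add M.hom_mult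
          mn.meval_mconst mn.meval_mvar)
  qed (simp only: G.comult_poly_simps N.comult_poly_simps mn.meval_mconst)
  show ?thesis
    unfolding comult_G.abs_eq coG coN G.quot_tensor_def[symmetric] N.quot_tensor_def[symmetric] 1 2 ..
qed

lift_definition comult_N :: "'k::field nrm_ring \<Rightarrow> ('k, 'k nrm_ring, 'k nrm_ring) tensor"
  is "\<lambda>a. tensor_map scale_N scale_N abs_nrm_ring abs_nrm_ring (comult_G a)"
proof -
  fix a b :: "'k gl2_ring"
  interpret N: gl2_point "\<lambda>c::'k. abs_nrm_ring (const_G c)" "\<lambda>p. abs_nrm_ring (abs_gl2_ring p)" scale_N
    by (rule gl2_point_N)
  interpret G: comm_ring_morphism "abs_gl2_ring :: (gl2_var, 'k) mpoly \<Rightarrow> _" by (rule abs_G_morphism)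
  interpret d: comm_ring_morphism N.\<delta> by (rule N.comult_poly_morphism)
  interpret c: comm_ring_morphism "mconst :: 'k nrm_ring \<Rightarrow> (gl2_var, 'k nrm_ring) mpoly"
    by (rule mconst_morphism)
  interpret m: comm_ring_morphism "meval (\<lambda>c::'k. mconst (abs_nrm_ring (const_G c)))
    (mvar :: gl2_var \<Rightarrow> (gl2_var, 'k nrm_ring) mpoly)"
    by (rule comm_ring_morphism.meval_morphism[OF morphism_comp[OF N.\<phi> mconst_morphism]])
  have K: "0 \<in> N.quot_kernel" "\<And>a b. a \<in> N.quot_kernel \<Longrightarrow> b \<in> N.quot_kernel \<Longrightarrow> a + b \<in> N.quot_kernel"
    "\<And>c a. a \<in> N.quot_kernel \<Longrightarrow> c * a \<in> N.quot_kernel"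
    using N.quot_kernel_is_ideal by (auto simp: is_ideal_iff)
  have coN: "coord_N v = (abs_nrm_ring (abs_gl2_ring (mvar v)) :: 'k nrm_ring)" for v
    by (simp add: coord_N_def coord_G.abs_eq)
  have mv: "meval (\<lambda>c::'k. mconst (abs_nrm_ring (const_G c))) mvar (mvar v) =
      (mvar v :: (gl2_var, 'k nrm_ring) mpoly)" for v
    by (rule comm_ring_morphism.meval_mvar[OF morphism_comp[OF N.\<phi> mconst_morphism]])
  have ex: "x = 1 \<or> x = 2" for x :: 2 using UNIV_index by auto
  have "mconst a * (mvar v * mvar w) \<in> N.quot_kernel"
    if "a = 0 \<or> coord_N v * coord_N w = (0 :: 'k nrm_ring)" for a v w
    using that
  proof
    assume "coord_N v * coord_N w = (0 :: 'k nrm_ring)"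
    then have "abs_nrm_ring (abs_gl2_ring (mvar v * mvar w)) = (0 :: 'k nrm_ring)"
      by (simp only: coN N.\<pi>.hom_mult)
    from N.quot_kernelI[OF this] show ?thesis by (simp only: m.hom_mult mv K)
  qed (simp add: c.hom_zero K)
  note kernel_term = this
  define H where "H = {a. \<exists>p. abs_gl2_ring p = a \<and> N.\<delta> p \<in> N.quot_kernel}"
  have "is_ideal H"
    unfolding is_ideal_iff
  proof (intro conjI ballI allI)
    show "0 \<in> H" unfolding H_def using G.hom_zero d.hom_zero K(1) by (auto intro!: exI[of _ 0])
    fix a c :: "'k gl2_ring" assume "a \<in> H"
    then obtain p where p: "abs_gl2_ring p = a" "N.\<delta> p \<in> N.quot_kernel" by (auto simp: H_def)
    obtain r where r: "c = abs_gl2_ring r" using abs_gl2_ring_surj ..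
    show "c * a \<in> H" unfolding H_def
      by (intro CollectI exI[of _ "r * p"]) (use p r K(3) in \<open>simp add: G.hom_mult d.hom_mult\<close>)
    assume "c \<in> H"
    then obtain q where q: "abs_gl2_ring q = c" "N.\<delta> q \<in> N.quot_kernel" by (auto simp: H_def)
    show "a + c \<in> H" unfolding H_def
      by (intro CollectI exI[of _ "p + q"]) (use p q K(2) in \<open>simp add: G.hom_add d.hom_add\<close>)
  qed
  moreover have "coord_G (X i j) * coord_G (X l l) \<in> H" if "i \<noteq> j" for i j l
  proof -
    have expand: "(mconst a * A + mconst b * B) * (mconst c * C + mconst e * E) =
      mconst (a * c) * (A * C) + mconst (a * e) * (A * E) + mconst (b * c) * (B * C) +
      mconst (b * e) * (B * E)" for a b c e and A B C E :: "(gl2_var, 'k nrm_ring) mpoly"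
      by (simp add: c.hom_mult algebra_simps)
    have "N.\<delta> (mvar (X i j) * mvar (X l l)) \<in> N.quot_kernel"
      unfolding d.hom_mult N.comult_poly_simps expand unfolding coN[symmetric]
      by (intro K(2) kernel_term) (use that ex[of i] ex[of j] ex[of l] in \<open>auto simp: coord_N_mult_zero\<close>)
    then show ?thesis
      by (auto simp: H_def coord_G.abs_eq G.hom_mult intro!: exI[of _ "mvar (X i j) * mvar (X l l)"])
  qed
  ultimately have "ideal_prod ideal_I1 ideal_I2 \<subseteq> H"
    unfolding ideal_I1_def ideal_I2_def by (intro ideal_prod_minimal) auto
  moreover assume "a - b \<in> ideal_prod ideal_I1 ideal_I2"
  ultimately obtain p where p: "abs_gl2_ring p = a - b" "N.\<delta> p \<in> N.quot_kernel"
    by (auto simp: H_def)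
  obtain q where q: "b = abs_gl2_ring q" using abs_gl2_ring_surj ..
  have a: "a = abs_gl2_ring (p + q)" by (simp add: G.hom_add p q[symmetric])
  show "tensor_map scale_N scale_N abs_nrm_ring abs_nrm_ring (comult_G a) =
    tensor_map scale_N scale_N abs_nrm_ring abs_nrm_ring (comult_G b)"
    unfolding a q comult_G_quotient coN[abs_def] N.quot_tensor_def[symmetric] d.hom_add N.quot_tensor_add
      N.quot_kernel_zero[OF p(2)] by simp
qed


section \<open>The comodules \<open>Sym\<^sup>d(V)\<^sup>i\<close>\<close>

text \<open>
  \<open>Sym(V)\<close> is the polynomial ring in \<open>e\<^sub>1, e\<^sub>2\<close>.  The comodule structure induced from \<open>V\<close> is the
  algebra homomorphism to \<open>k[G] \<otimes> Sym(V)\<close> extending \<open>e\<^sub>i \<mapsto> \<Sum>\<^sub>j x\<^sub>i\<^sub>j \<otimes> e\<^sub>j\<close>; it preserves the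
  homogeneous part \<open>Sym\<^sup>d(V)\<close>.  \<open>sym_vec d i\<close> is \<open>v\<^sub>i = e\<^sub>1\<^sup>d\<^sup>-\<^sup>ie\<^sub>2\<^sup>i\<close> and \<open>sym_part d i\<close> is
  \<open>Sym\<^sup>d(V)\<^sup>i\<close>, for \<open>i \<le> d\<close>.
\<close>

type_synonym 'k sym = "(2, 'k) mpoly"

definition coaction_G :: "'k::field sym \<Rightarrow> ('k, 'k gl2_ring, 'k sym) tensor"
  where "coaction_G p = mpoly_tensor scale_G (meval (\<lambda>c. mconst (const_G c))
    (\<lambda>i. \<Sum>j\<in>UNIV. mconst (coord_G (X i j)) * mvar j) p)"

definition coaction_N :: "'k::field sym \<Rightarrow> ('k, 'k nrm_ring, 'k sym) tensor"
  where "coaction_N p = tensor_map scale_N mscale abs_nrm_ring id (coaction_G p)"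

definition sym_vec :: "nat \<Rightarrow> nat \<Rightarrow> 'k::field sym"
  where "sym_vec d i = mvar 1 ^ (d - i) * mvar 2 ^ i"

definition sym_part :: "nat \<Rightarrow> nat \<Rightarrow> 'k::field sym set"
  where "sym_part d i = module.span mscale {sym_vec d i, sym_vec d (d - i)}"

lemma power_add_orthogonal:
  fixes x y X Y :: "'a::comm_ring_1"
  assumes "x * y = 0"
  shows "(x * X + y * Y) ^ Suc n = x ^ Suc n * X ^ Suc n + y ^ Suc n * Y ^ Suc n"
proof (induction n)
  case (Suc n)
  have "(x * X) * (y ^ Suc n * Y ^ Suc n) = (x * y) * (X * y ^ n * Y ^ Suc n)"
    and "(y * Y) * (x ^ Suc n * X ^ Suc n) = (x * y) * (Y * x ^ n * X ^ Suc n)"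
    by (simp_all add: ac_simps)
  then have "(x * X) * (y ^ Suc n * Y ^ Suc n) = 0" "(y * Y) * (x ^ Suc n * X ^ Suc n) = 0"
    using assms by simp_all
  moreover have "(x * X + y * Y) ^ Suc (Suc n) =
    (x * X + y * Y) * (x ^ Suc n * X ^ Suc n + y ^ Suc n * Y ^ Suc n)"
    by (subst power_Suc) (simp only: Suc)
  moreover have "\<dots> = x ^ Suc (Suc n) * X ^ Suc (Suc n) + y ^ Suc (Suc n) * Y ^ Suc (Suc n) +
    (x * X) * (y ^ Suc n * Y ^ Suc n) + (y * Y) * (x ^ Suc n * X ^ Suc n)"
    by (simp add: algebra_simps)
  ultimately show ?case by simp
qed simp

lemma power_mult_orthogonal:
  fixes a b c e E F :: "'a::comm_ring_1"
  assumes "a * b = 0" "a * c = 0" "b * e = 0" "c * e = 0" "1 \<le> m + n"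
  shows "(a * E + b * F) ^ m * (c * E + e * F) ^ n =
    a ^ m * e ^ n * (E ^ m * F ^ n) + b ^ m * c ^ n * (E ^ n * F ^ m)"
proof (cases m)
  case 0
  then obtain n' where n: "n = Suc n'" using assms(5) by (cases n) auto
  show ?thesis unfolding 0 n power_add_orthogonal[OF assms(4)] by simp
next
  case m: (Suc m')
  show ?thesis
  proof (cases n)
    case 0
    show ?thesis unfolding 0 m power_add_orthogonal[OF assms(1)] by simp
  next
    case n: (Suc n')
    have "a ^ Suc m' * c ^ Suc n' = (a * c) * (a ^ m' * c ^ n')"
      "b ^ Suc m' * e ^ Suc n' = (b * e) * (b ^ m' * e ^ n')"
      by (simp_all add: ac_simps)
    then have z: "a ^ Suc m' * c ^ Suc n' = 0" "b ^ Suc m' * e ^ Suc n' = 0"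
      using assms by simp_all
    have "(a ^ m * E ^ m + b ^ m * F ^ m) * (c ^ n * E ^ n + e ^ n * F ^ n) =
      a ^ m * e ^ n * (E ^ m * F ^ n) + b ^ m * c ^ n * (E ^ n * F ^ m) +
      (a ^ m * c ^ n) * (E ^ m * E ^ n) + (b ^ m * e ^ n) * (F ^ m * F ^ n)"
      by (simp add: algebra_simps)
    then show ?thesis
      unfolding m n power_add_orthogonal[OF assms(1)] power_add_orthogonal[OF assms(4)] z by simp
  qed
qed
text \<open>The formula \<open>\<Delta>\<^sup>i(v\<^sub>i) = t\<^sub>1\<^sup>d\<^sup>-\<^sup>it\<^sub>2\<^sup>i \<otimes> v\<^sub>i + u\<^sub>1\<^sup>d\<^sup>-\<^sup>iu\<^sub>2\<^sup>i \<otimes> v\<^sub>d\<^sub>-\<^sub>i\<close>, where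
  \<open>t\<^sub>1, t\<^sub>2, u\<^sub>1, u\<^sub>2\<close> are the images of \<open>x\<^sub>1\<^sub>1, x\<^sub>2\<^sub>2, x\<^sub>1\<^sub>2, x\<^sub>2\<^sub>1\<close> in \<open>k[N]\<close>.\<close>

lemma coaction_N_sym_vec:
  assumes "1 \<le> d" "i \<le> d"
  shows "coaction_N (sym_vec d i :: 'k::field sym) =
    tensor scale_N mscale (coord_N (X 1 1) ^ (d - i) * coord_N (X 2 2) ^ i) (sym_vec d i) +
    tensor scale_N mscale (coord_N (X 1 2) ^ (d - i) * coord_N (X 2 1) ^ i) (sym_vec d (d - i))"
proof -
  interpret G: gl2_point "const_G :: 'k \<Rightarrow> _" abs_gl2_ring scale_G by (rule gl2_point_G)
  interpret N: gl2_point "\<lambda>c::'k. abs_nrm_ring (const_G c)" "\<lambda>p. abs_nrm_ring (abs_gl2_ring p)" scale_N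
    by (rule gl2_point_N)
  interpret mn: comm_ring_morphism "\<lambda>a. mconst (abs_nrm_ring a) :: (2, 'k nrm_ring) mpoly"
    by (rule morphism_comp[OF abs_N_morphism mconst_morphism])
  interpret mG: comm_ring_morphism "\<lambda>c. mconst (const_G c) :: (2, 'k gl2_ring) mpoly"
    by (rule morphism_comp[OF G.\<phi> mconst_morphism])
  interpret c: comm_ring_morphism "mconst :: 'k nrm_ring \<Rightarrow> (2, 'k nrm_ring) mpoly"
    by (rule mconst_morphism)
  let ?M = "meval (\<lambda>a. mconst (abs_nrm_ring a)) mvar :: (2, 'k gl2_ring) mpoly \<Rightarrow> (2, 'k nrm_ring) mpoly"
  let ?\<sigma> = "meval (\<lambda>c. mconst (const_G c)) (\<lambda>i. \<Sum>j\<in>UNIV. mconst (coord_G (X i j)) * mvar j)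
    :: 'k sym \<Rightarrow> (2, 'k gl2_ring) mpoly"
  interpret M: comm_ring_morphism ?M by (rule mn.meval_morphism)
  interpret \<sigma>: comm_ring_morphism ?\<sigma> by (rule mG.meval_morphism)
  note vsN = N.sA_vector_space mscale_vector_space
  have idl: "Vector_Spaces.linear (mscale :: 'k \<Rightarrow> 'k sym \<Rightarrow> _) mscale id"
    using mscale_vector_space by (auto simp: Vector_Spaces.linear_iff)
  have base: "tensor_map scale_N mscale abs_nrm_ring id (mpoly_tensor scale_G q) = mpoly_tensor scale_N (?M q)" for q
  proof (induction q rule: mpoly_induct)
    case (single m a)
    show ?case
      by (simp only: meval_coeff_map[OF abs_N_morphism] mpoly_tensor_single[OF G.sA_vector_space]
          mpoly_tensor_single[OF N.sA_vector_space] tensor_map_tensor[OF abs_N_linear idl])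
        (simp only: id_apply)
  next
    case (add p q)
    then show ?case
      by (simp only: M.hom_add tensor_map_add mpoly_tensor_add[OF G.sA_vector_space]
          mpoly_tensor_add[OF N.sA_vector_space])
  qed
  have gen: "?M (?\<sigma> (mvar i)) = mconst (coord_N (X i 1)) * mvar 1 + mconst (coord_N (X i 2)) * mvar 2" for i
    by (simp add: mG.meval_mvar UNIV_index M.hom_add M.hom_mult mn.meval_mconst mn.meval_mvar coord_N_def)
  have mono: "mvar 1 ^ m * mvar 2 ^ n =
    (Poly_Mapping.single (Poly_Mapping.single 1 m + Poly_Mapping.single 2 n) 1 :: (2, 'r::comm_ring_1) mpoly)"
    for m n by (simp add: mvar_power mult_single)
  have "?M (?\<sigma> (sym_vec d i)) =
    (mconst (coord_N (X 1 1)) * mvar 1 + mconst (coord_N (X 1 2)) * mvar 2) ^ (d - i) *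
    (mconst (coord_N (X 2 1)) * mvar 1 + mconst (coord_N (X 2 2)) * mvar 2) ^ i"
    by (simp only: sym_vec_def \<sigma>.hom_mult M.hom_mult morphism_power[OF \<sigma>.comm_ring_morphism_axioms]
        morphism_power[OF M.comm_ring_morphism_axioms] gen)
  also have "\<dots> =
    mconst (coord_N (X 1 1)) ^ (d - i) * mconst (coord_N (X 2 2)) ^ i * (mvar 1 ^ (d - i) * mvar 2 ^ i) +
    mconst (coord_N (X 1 2)) ^ (d - i) * mconst (coord_N (X 2 1)) ^ i * (mvar 1 ^ i * mvar 2 ^ (d - i))"
    by (rule power_mult_orthogonal)
      (use assms in \<open>simp_all add: coord_N_mult_zero c.hom_zero flip: c.hom_mult\<close>)
  also have "\<dots> =
    mconst (coord_N (X 1 1) ^ (d - i) * coord_N (X 2 2) ^ i) * (mvar 1 ^ (d - i) * mvar 2 ^ i) +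
    mconst (coord_N (X 1 2) ^ (d - i) * coord_N (X 2 1) ^ i) * (mvar 1 ^ i * mvar 2 ^ (d - i))"
    by (simp only: c.hom_mult morphism_power[OF c.comm_ring_morphism_axioms])
  finally have key: "?M (?\<sigma> (sym_vec d i)) =
    mconst (coord_N (X 1 1) ^ (d - i) * coord_N (X 2 2) ^ i) * (mvar 1 ^ (d - i) * mvar 2 ^ i) +
    mconst (coord_N (X 1 2) ^ (d - i) * coord_N (X 2 1) ^ i) * (mvar 1 ^ i * mvar 2 ^ (d - i))" .
  have scaled: "mpoly_tensor scale_N (mconst r * (mvar 1 ^ m * mvar 2 ^ n)) =
    tensor scale_N mscale r (mvar 1 ^ m * mvar 2 ^ n :: 'k sym)" for r m n
    unfolding mono by (simp add: mconst_def mult_single mpoly_tensor_single[OF N.sA_vector_space])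
  have "d - (d - i) = i" using assms by simp
  then show ?thesis
    unfolding coaction_N_def coaction_G_def base key
    by (simp only: mpoly_tensor_add[OF N.sA_vector_space] scaled sym_vec_def)
qed

end

theory Submission
  imports Defs
begin

text \<open>
  The comodule axioms are linear, so they are checked on \<open>v\<^sub>i\<close>, where both sides of coassociativity
  expand to the same four elementary tensors.  For irreducibility, a functional on \<open>k[N]\<close> contracts
  \<open>\<Delta>\<^sup>i(u)\<close> to an element of every subcomodule containing \<open>u\<close>.  The functionals used are the
  coefficients of two algebra homomorphisms from \<open>k[N]\<close> to the Laurent polynomials in \<open>s\<close>, one
  for each component of \<open>N\<close>: \<open>(t\<^sub>1, t\<^sub>2) \<mapsto> (s, 1)\<close> and \<open>(u\<^sub>1, u\<^sub>2) \<mapsto> (s, 1)\<close>.  Applied to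
  \<open>u = a v\<^sub>i + b v\<^sub>d\<^sub>-\<^sub>i\<close> with \<open>d \<noteq> 2i\<close> they give \<open>a v\<^sub>i\<close>, \<open>b v\<^sub>d\<^sub>-\<^sub>i\<close>, \<open>a v\<^sub>d\<^sub>-\<^sub>i\<close> and \<open>b v\<^sub>i\<close>.
\<close>

section \<open>Tensors\<close>

lemma module_tensor_scale: "module (tensor_scale :: 'k::field \<Rightarrow> ('f \<Rightarrow> 'k) \<Rightarrow> 'f \<Rightarrow> 'k)"
  by (simp add: module_iff_vector_space vector_space_tensor_scale)

lemma subspace_tensor_product: "module.subspace tensor_scale (tensor_product sA sB A B)"
  unfolding tensor_product_def by (rule module.subspace_span[OF module_tensor_scale])

lemma tensor_in_tensor_product: "a \<in> A \<Longrightarrow> b \<in> B \<Longrightarrow> tensor sA sB a b \<in> tensor_product sA sB A B"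
  unfolding tensor_product_def by (rule module.span_base[OF module_tensor_scale]) auto

lemma tensor_product_minimal:
  assumes "T \<in> tensor_product sA sB A B" "module.subspace tensor_scale S"
    "\<And>a b. a \<in> A \<Longrightarrow> b \<in> B \<Longrightarrow> tensor sA sB a b \<in> S"
  shows "T \<in> S"
proof -
  have "{tensor sA sB a b |a b. a \<in> A \<and> b \<in> B} \<subseteq> S" using assms(3) by blast
  from module.span_minimal[OF module_tensor_scale this assms(2)] show ?thesis
    using assms(1) by (auto simp: tensor_product_def)
qed

lemma tensor_scale_apply [simp]: "tensor_scale c T \<beta> = c * T \<beta>"
  by (simp add: tensor_scale_def)

text \<open>The type of tensors contains arbitrary functions of forms. Evaluation is linear in the
  form on the span of elementary tensors: there it is evaluation at a pair, and linearity survives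
  sums and multiples.\<close>

lemma linear_tensor_eval:
  assumes "T \<in> tensor_product sA sB A B" "vector_space sX"
    and "\<And>x. bilinear sA sB (*) (G x)" "\<And>a b. Vector_Spaces.linear sX (*) (\<lambda>x. G x a b)"
  shows "Vector_Spaces.linear sX (*) (\<lambda>x. T (G x))"
proof -
  let ?S = "{T. Vector_Spaces.linear sX (*) (\<lambda>x. T (G x))}"
  have "T \<in> ?S"
  proof (rule tensor_product_minimal[OF assms(1)])
    show "module.subspace tensor_scale ?S"
      using assms(2) vector_space_mult
      by (auto simp: module.subspace_def[OF module_tensor_scale] Vector_Spaces.linear_iff algebra_simps)
  next
    fix a b show "tensor sA sB a b \<in> ?S" using assms(3,4) by (simp add: tensor_def)
  qed
  then show ?thesis by simp
qed

text \<open>The vector \<open>w\<close> is the contraction of \<open>T\<close> by \<open>f\<close>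
  in the first factor, pinned down only through its values under linear forms, so that no
  contraction map has to be built. If \<open>w\<close> lay outside \<open>U\<close>, some linear
  form would vanish on \<open>U\<close> and be 1 at \<open>w\<close>. Its product with
  \<open>f\<close> kills every elementary tensor with second entry in \<open>U\<close>, so
  \<open>T\<close> would take the value 0 there instead of 1.\<close>

lemma contraction_in_subspace:
  fixes f :: "'c::ab_group_add \<Rightarrow> 'k::field" and sV :: "'k \<Rightarrow> 'v::ab_group_add \<Rightarrow> 'v"
  assumes T: "T \<in> tensor_product sC sV A U" and U: "module.subspace sV U"
    and V: "vector_space sV" and f: "Vector_Spaces.linear sC (*) f"
    and w: "\<And>\<phi>. Vector_Spaces.linear sV (*) \<phi> \<Longrightarrow> T (\<lambda>c v. f c * \<phi> v) = \<phi> w"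
  shows "w \<in> U"
proof (rule ccontr)
  assume "w \<notin> U"
  interpret V: vector_space sV by fact
  interpret K: vector_space "(*) :: 'k \<Rightarrow> 'k \<Rightarrow> 'k" by (rule vector_space_mult)
  interpret VK: vector_space_pair sV "(*) :: 'k \<Rightarrow> 'k \<Rightarrow> 'k" ..
  interpret f: Vector_Spaces.linear sC "(*)" f by fact
  obtain B where B: "B \<subseteq> U" "V.independent B" "V.span B = U"
    using V.basis_exists[of U] U by (metis V.span_eq_iff V.span_mono subset_antisym)
  then have "V.independent (insert w B)"
    using \<open>w \<notin> U\<close> by (intro V.independent_insertI) auto
  then obtain \<phi> where \<phi>: "Vector_Spaces.linear sV (*) \<phi>"
    "\<forall>x\<in>insert w B. \<phi> x = (if x = w then 1 else 0 :: 'k)"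
    using VK.linear_independent_extend[of "insert w B" "\<lambda>x. if x = w then 1 else 0"] by blast
  interpret \<phi>: Vector_Spaces.linear sV "(*)" \<phi> by fact
  have "\<phi> x = 0" if "x \<in> U" for x
    by (rule \<phi>.eq_0_on_span[of B]) (use B \<phi>(2) \<open>w \<notin> U\<close> that in auto)
  then have "tensor sC sV c v (\<lambda>c v. f c * \<phi> v) = 0" if "v \<in> U" for c v
    using that by (simp add: tensor_def)
  then have "T \<in> {T. T (\<lambda>c v. f c * \<phi> v) = 0}"
    by (intro tensor_product_minimal[OF T])
      (auto simp: module.subspace_def[OF module_tensor_scale])
  with w[OF \<phi>(1)] \<phi>(2) show False by simp
qed

section \<open>Bilinear forms from linear functionals and from trilinear forms\<close>

lemma bilinear_mult:
  assumes "Vector_Spaces.linear sC (*) f" "Vector_Spaces.linear sV (*) \<phi>"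
  shows "bilinear sC sV (*) (\<lambda>c v. f c * \<phi> v)"
  using assms by (simp add: bilinear_def Vector_Spaces.linear_iff distrib_left distrib_right mult.assoc mult.left_commute)

text \<open>This is the form at which \<open>id_tensor_coaction\<close> evaluates its argument.
  Since \<open>tensor\<close> sends functions that are not bilinear to 0, its bilinearity must be
  known before an elementary tensor can be evaluated at it.\<close>

lemma bilinear_coaction_slice:
  assumes "trilinear sC sC sV \<gamma>" "vector_space sC" "vector_space sV"
    and "Vector_Spaces.linear sV tensor_scale \<rho>" "\<And>v. \<rho> v \<in> tensor_product sC sV A B"
  shows "bilinear sC sV (*) (\<lambda>a v. \<rho> v (\<gamma> a))"
  unfolding bilinear_def
proof (intro conjI allI)
  fix v show "Vector_Spaces.linear sC (*) (\<lambda>a. \<rho> v (\<gamma> a))"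
    by (rule linear_tensor_eval[OF assms(5,2)]) (use assms(1) in \<open>auto simp: bilinear_def trilinear_def\<close>)
next
  fix a show "Vector_Spaces.linear sV (*) (\<lambda>v. \<rho> v (\<gamma> a))"
    using assms(3,4) vector_space_mult by (auto simp: Vector_Spaces.linear_iff)
qed

text \<open>The same check for \<open>comult_tensor_id\<close>. The roles are exchanged: linearity
  in \<open>c\<close> comes from \<Delta>, linearity in \<open>v\<close> from the dependence of the
  slice on \<open>v\<close>.\<close>

lemma bilinear_comult_slice:
  assumes "trilinear sC sC sV \<gamma>" "vector_space sC" "vector_space sV"
    and "Vector_Spaces.linear sC tensor_scale \<Delta>" "\<And>c. \<Delta> c \<in> tensor_product sC sC A B"
  shows "bilinear sC sV (*) (\<lambda>c v. \<Delta> c (\<lambda>a b. \<gamma> a b v))"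
  unfolding bilinear_def
proof (intro conjI allI)
  fix c show "Vector_Spaces.linear sV (*) (\<lambda>v. \<Delta> c (\<lambda>a b. \<gamma> a b v))"
    by (rule linear_tensor_eval[OF assms(5,3)]) (use assms(1) in \<open>auto simp: bilinear_def trilinear_def\<close>)
next
  fix v show "Vector_Spaces.linear sC (*) (\<lambda>c. \<Delta> c (\<lambda>a b. \<gamma> a b v))"
    using assms(2,4) vector_space_mult by (auto simp: Vector_Spaces.linear_iff)
qed

lemma trilinear_slice: "trilinear sA sB sC \<gamma> \<Longrightarrow> bilinear sA sB (*) (\<lambda>a b. \<gamma> a b c)"
  "trilinear sA sB sC \<gamma> \<Longrightarrow> bilinear sB sC (*) (\<gamma> a)"
  by (auto simp: bilinear_def trilinear_def)

section \<open>The structure maps of \<open>k[N]\<close>\<close>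

abbreviation const_N :: "'k::field \<Rightarrow> 'k nrm_ring"
  where "const_N c \<equiv> abs_nrm_ring (const_G c)"

abbreviation proj_N :: "(gl2_var, 'k::field) mpoly \<Rightarrow> 'k nrm_ring"
  where "proj_N p \<equiv> abs_nrm_ring (abs_gl2_ring p)"

lemma proj_N_surj: "\<exists>p. a = proj_N p"
  using abs_nrm_ring_surj[of a] abs_gl2_ring_surj by metis

lemma coord_N_eq: "coord_N v = proj_N (mvar v)"
  by (simp add: coord_N_def coord_G.abs_eq)

lemma vector_space_scale_N: "vector_space (scale_N :: 'k::field \<Rightarrow> _)"
  using gl2_point.sA_vector_space[OF gl2_point_N] .

lemma (in gl2_point) quot_tensor_in_tensor_product:
  "quot_tensor q \<in> tensor_product sA sA UNIV UNIV"
proof (induction q rule: mpoly_induct)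
  case (single m c)
  show ?case unfolding quot_tensor_single by (rule tensor_in_tensor_product) auto
next
  case (add p q)
  then show ?case unfolding quot_tensor_add
    by (rule module.subspace_add[OF module_tensor_scale subspace_tensor_product])
qed

lemma (in gl2_point) quot_tensor_scale: "quot_tensor (mconst (\<phi> c) * q) = tensor_scale c (quot_tensor q)"
proof (induction q rule: mpoly_induct)
  case (single m a)
  show ?case
    by (simp add: mconst_def mult_single quot_tensor_single sA[symmetric]
        tensor_simps[OF sA_vector_space sA_vector_space])
next
  case (add p q)
  then show ?case
    by (simp add: distrib_left quot_tensor_add fun_eq_iff algebra_simps)
qed

text \<open>On polynomial representatives the comultiplication is a ring homomorphism followed by
  the additive map \<open>quot_tensor\<close>. Powers and products can thus be expanded in a
  polynomial ring over k[N] before passing to tensors.\<close>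

lemma comult_N_proj:
  "comult_N (proj_N p) = gl2_point.quot_tensor proj_N scale_N
    (comult_poly (const_N :: 'k::field \<Rightarrow> _) (\<lambda>v. proj_N (mvar v)) p)"
  using comult_G_quotient[of p]
  by (simp add: comult_N.abs_eq gl2_point.quot_tensor_def[OF gl2_point_N] coord_N_eq[abs_def])

lemma comult_N_in_tensor_product:
  "comult_N (c :: 'k::field nrm_ring) \<in> tensor_product scale_N scale_N UNIV UNIV"
proof -
  obtain p where p: "c = proj_N p" using proj_N_surj ..
  show ?thesis unfolding p comult_N_proj
    by (rule gl2_point.quot_tensor_in_tensor_product[OF gl2_point_N])
qed

lemma comult_N_linear:
  "Vector_Spaces.linear scale_N tensor_scale (comult_N :: 'k::field nrm_ring \<Rightarrow> _)"
proof -
  interpret N: gl2_point "const_N :: 'k \<Rightarrow> _" proj_N scale_N by (rule gl2_point_N)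
  interpret d: comm_ring_morphism N.\<delta> by (rule N.comult_poly_morphism)
  show ?thesis
    unfolding Vector_Spaces.linear_iff
  proof (intro conjI allI vector_space_scale_N vector_space_tensor_scale)
    fix a b :: "'k nrm_ring" and c :: 'k
    obtain p where p: "a = proj_N p" using proj_N_surj ..
    obtain q where q: "b = proj_N q" using proj_N_surj ..
    show "comult_N (a + b) = comult_N a + comult_N b"
      unfolding p q N.\<pi>.hom_add[symmetric] comult_N_proj d.hom_add N.quot_tensor_add ..
    have "scale_N c a = proj_N (mconst c * p)"
      by (simp only: p N.sA N.\<pi>_mconst N.\<pi>.hom_mult)
    then show "comult_N (scale_N c a) = tensor_scale c (comult_N a)"
      by (simp only: p comult_N_proj d.hom_mult N.comult_poly_simps N.quot_tensor_scale)
  qed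
qed

text \<open>The variant of \<open>power_mult_orthogonal\<close> with four independent right factors,
  as needed when the two matrix entries lie in different columns. The mixed terms contain a * c or b
  * e and vanish. For m = n = 0 the left side would be 1 and the right side 2.\<close>

lemma power_mult_orthogonal4:
  fixes a b c e :: "'a::comm_ring_1"
  assumes "a * b = 0" "a * c = 0" "b * e = 0" "c * e = 0" "1 \<le> m + n"
  shows "(a * E + b * F) ^ m * (c * G + e * H) ^ n =
    a ^ m * e ^ n * (E ^ m * H ^ n) + b ^ m * c ^ n * (F ^ m * G ^ n)"
proof (cases m)
  case 0
  then obtain n' where n: "n = Suc n'" using assms(5) by (cases n) auto
  show ?thesis unfolding 0 n power_add_orthogonal[OF assms(4)] by simp
next
  case m: (Suc m')
  show ?thesis
  proof (cases n)
    case 0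
    show ?thesis unfolding 0 m power_add_orthogonal[OF assms(1)] by simp
  next
    case n: (Suc n')
    have "a ^ Suc m' * c ^ Suc n' = (a * c) * (a ^ m' * c ^ n')"
      "b ^ Suc m' * e ^ Suc n' = (b * e) * (b ^ m' * e ^ n')"
      by (simp_all add: ac_simps)
    then have z: "a ^ m * c ^ n = 0" "b ^ m * e ^ n = 0"
      using assms m n by simp_all
    have "(a ^ m * E ^ m + b ^ m * F ^ m) * (c ^ n * G ^ n + e ^ n * H ^ n) =
      a ^ m * e ^ n * (E ^ m * H ^ n) + b ^ m * c ^ n * (F ^ m * G ^ n) +
      (a ^ m * c ^ n) * (E ^ m * G ^ n) + (b ^ m * e ^ n) * (F ^ m * H ^ n)"
      by (simp add: algebra_simps)
    then show ?thesis
      using power_add_orthogonal[OF assms(1), of E F m'] power_add_orthogonal[OF assms(4), of G H n'] z m n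
      by simp
  qed
qed

text \<open>As i and j are the two indices, x_il goes to x_ii \<otimes> x_il + x_ij \<otimes> x_jl.
  The left factors are diagonal and off-diagonal entries, whose products vanish in k[N], so powers
  create no mixed terms. The columns l and l' stay free, which covers the monomials in t and those
  in u at once.\<close>

lemma comult_N_monomial:
  assumes "1 \<le> m + n" "i \<noteq> j"
  shows "comult_N (coord_N (X i l) ^ m * coord_N (X j l') ^ n :: 'k::field nrm_ring) =
    tensor scale_N scale_N (coord_N (X i i) ^ m * coord_N (X j j) ^ n)
      (coord_N (X i l) ^ m * coord_N (X j l') ^ n) +
    tensor scale_N scale_N (coord_N (X i j) ^ m * coord_N (X j i) ^ n)
      (coord_N (X j l) ^ m * coord_N (X i l') ^ n)"
proof -
  interpret N: gl2_point "const_N :: 'k \<Rightarrow> _" proj_N scale_N by (rule gl2_point_N)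
  interpret d: comm_ring_morphism N.\<delta> by (rule N.comult_poly_morphism)
  interpret c: comm_ring_morphism "mconst :: 'k nrm_ring \<Rightarrow> (gl2_var, 'k nrm_ring) mpoly"
    by (rule mconst_morphism)
  let ?M = "meval (\<lambda>c::'k. mconst (const_N c)) mvar :: _ \<Rightarrow> (gl2_var, 'k nrm_ring) mpoly"
  interpret M: comm_ring_morphism ?M
    by (rule comm_ring_morphism.meval_morphism[OF morphism_comp[OF N.\<phi> mconst_morphism]])
  have mv: "?M (mvar v) = mvar v" for v
    by (rule comm_ring_morphism.meval_mvar[OF morphism_comp[OF N.\<phi> mconst_morphism]])
  have ex: "x = 1 \<or> x = 2" for x :: 2 using UNIV_index by auto
  have \<delta>: "N.\<delta> (mvar (X h l)) = mconst (coord_N (X h i)) * mvar (X i l) + mconst (coord_N (X h j)) * mvar (X j l)" for h l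
    unfolding N.comult_poly_simps coord_N_eq using ex[of i] ex[of j] assms(2) by (auto simp: add.commute)
  \<comment> \<open>The monomial has coefficients from k, so it is the image of a polynomial over k
    under \<open>?M\<close>; \<open>quot_tensor_right\<close> then applies with the constant
    monomial 0 carrying the coefficient \<open>r\<close>.\<close>
  have right: "N.quot_tensor (mconst r * (mvar v ^ m * mvar w ^ n)) =
    tensor scale_N scale_N r (coord_N v ^ m * coord_N w ^ n)" for r v w
  proof -
    have "mvar v ^ m * mvar w ^ n = ?M (mvar v ^ m * mvar w ^ n)"
      by (simp only: M.hom_mult morphism_power[OF M.comm_ring_morphism_axioms] mv)
    then show ?thesis
      using N.quot_tensor_right[of 0 r "mvar v ^ m * mvar w ^ n"]
      by (simp add: mconst_def coord_N_eq N.\<pi>.hom_mult morphism_power[OF N.\<pi>])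
  qed
  have "comult_N (coord_N (X i l) ^ m * coord_N (X j l') ^ n :: 'k nrm_ring) =
    N.quot_tensor (N.\<delta> (mvar (X i l)) ^ m * N.\<delta> (mvar (X j l')) ^ n)"
    by (simp only: coord_N_eq morphism_power[OF N.\<pi>, symmetric] N.\<pi>.hom_mult[symmetric] comult_N_proj
        d.hom_mult morphism_power[OF d.comm_ring_morphism_axioms])
  also have "N.\<delta> (mvar (X i l)) ^ m * N.\<delta> (mvar (X j l')) ^ n =
    mconst (coord_N (X i i)) ^ m * mconst (coord_N (X j j)) ^ n * (mvar (X i l) ^ m * mvar (X j l') ^ n) +
    mconst (coord_N (X i j)) ^ m * mconst (coord_N (X j i)) ^ n * (mvar (X j l) ^ m * mvar (X i l') ^ n)"
    unfolding \<delta> by (rule power_mult_orthogonal4)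
      (use assms in \<open>simp_all add: coord_N_mult_zero c.hom_zero flip: c.hom_mult\<close>)
  finally show ?thesis
    by (simp only: N.quot_tensor_add right c.hom_mult[symmetric]
        morphism_power[OF c.comm_ring_morphism_axioms, symmetric])
qed

section \<open>The counit of k[N] as a linear algebra homomorphism\<close>

lemma counit_N_proj: "counit_N (proj_N p) = meval (\<lambda>c. c) unit_point p"
  by (simp add: counit_N.abs_eq counit_G_abs)

lemma counit_N_morphism: "comm_ring_morphism (counit_N :: 'k::field nrm_ring \<Rightarrow> 'k)"
proof -
  interpret N: gl2_point "const_N :: 'k \<Rightarrow> _" proj_N scale_N by (rule gl2_point_N)
  interpret m: comm_ring_morphism "meval (\<lambda>c. c) (unit_point :: gl2_var \<Rightarrow> 'k)"
    by (rule comm_ring_morphism.meval_morphism[OF id_morphism])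
  show ?thesis
  proof
    show "counit_N 1 = (1 :: 'k)"
      unfolding N.\<pi>.hom_one[symmetric] counit_N_proj by (rule m.hom_one)
    fix a b :: "'k nrm_ring"
    obtain p where p: "a = proj_N p" using proj_N_surj ..
    obtain q where q: "b = proj_N q" using proj_N_surj ..
    show "counit_N (a + b) = counit_N a + counit_N b"
      unfolding p q N.\<pi>.hom_add[symmetric] counit_N_proj by (rule m.hom_add)
    show "counit_N (a * b) = counit_N a * counit_N b"
      unfolding p q N.\<pi>.hom_mult[symmetric] counit_N_proj by (rule m.hom_mult)
  qed
qed

lemma counit_N_simps:
  "counit_N (coord_N (X i j)) = (if i = j then 1 else 0 :: 'k::field)"
  "counit_N (const_N c) = (c :: 'k)"
  using comm_ring_morphism.meval_mvar[OF id_morphism, of "unit_point :: _ \<Rightarrow> 'k" "X i j"]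
    comm_ring_morphism.meval_mconst[OF id_morphism, of "unit_point :: _ \<Rightarrow> 'k" c]
  by (simp_all add: coord_N_eq counit_N_proj unit_point_def const_G.abs_eq)

lemma counit_N_linear: "Vector_Spaces.linear scale_N (*) (counit_N :: 'k::field nrm_ring \<Rightarrow> _)"
proof -
  interpret e: comm_ring_morphism "counit_N :: 'k nrm_ring \<Rightarrow> 'k" by (rule counit_N_morphism)
  show ?thesis
    using vector_space_scale_N vector_space_mult
    by (auto simp: Vector_Spaces.linear_iff e.hom_add e.hom_mult scale_N_def counit_N_simps)
qed

section \<open>The coaction on \<open>Sym\<^sup>d(V)\<^sup>i\<close>\<close>

lemma mpoly_tensor_in_tensor_product:
  assumes "vector_space sA"
  shows "mpoly_tensor sA q \<in> tensor_product sA mscale UNIV UNIV"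
proof (induction q rule: mpoly_induct)
  case (single m c)
  show ?case unfolding mpoly_tensor_single[OF assms] by (rule tensor_in_tensor_product) auto
next
  case (add p q)
  then show ?case unfolding mpoly_tensor_add[OF assms]
    by (rule module.subspace_add[OF module_tensor_scale subspace_tensor_product])
qed

lemma tensor_map_scale: "tensor_map sC sD f g (tensor_scale c T) = tensor_scale c (tensor_map sC sD f g T)"
  by (auto simp: tensor_map_def fun_eq_iff)

lemma tensor_map_in_tensor_product:
  assumes "T \<in> tensor_product sA sB A B" "Vector_Spaces.linear sA sC f" "Vector_Spaces.linear sB sD g"
  shows "tensor_map sC sD f g T \<in> tensor_product sC sD (f ` A) (g ` B)"
proof -
  let ?S = "{T. tensor_map sC sD f g T \<in> tensor_product sC sD (f ` A) (g ` B)}"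
  have "T \<in> ?S"
  proof (rule tensor_product_minimal[OF assms(1)])
    have "tensor_map sC sD f g 0 = 0" by (auto simp: tensor_map_def fun_eq_iff)
    then show "module.subspace tensor_scale ?S"
      using subspace_tensor_product[of sC sD "f ` A" "g ` B"]
      by (simp add: module.subspace_def[OF module_tensor_scale] tensor_map_add tensor_map_scale)
  qed (use assms in \<open>simp add: tensor_map_tensor tensor_in_tensor_product\<close>)
  then show ?thesis by simp
qed

lemma coaction_N_in_tensor_product:
  "coaction_N (p :: 'k::field sym) \<in> tensor_product scale_N mscale UNIV UNIV"
proof -
  interpret G: gl2_point "const_G :: 'k \<Rightarrow> _" abs_gl2_ring scale_G by (rule gl2_point_G)
  have idl: "Vector_Spaces.linear (mscale :: 'k \<Rightarrow> 'k sym \<Rightarrow> _) mscale id"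
    using mscale_vector_space by (auto simp: Vector_Spaces.linear_iff)
  have "coaction_N p \<in> tensor_product scale_N mscale (abs_nrm_ring ` UNIV) (id ` UNIV)"
    unfolding coaction_N_def coaction_G_def
    by (rule tensor_map_in_tensor_product[OF mpoly_tensor_in_tensor_product[OF G.sA_vector_space]
          abs_N_linear idl])
  moreover have "range (abs_nrm_ring :: 'k gl2_ring \<Rightarrow> _) = UNIV"
    using abs_nrm_ring_surj by blast
  ultimately show ?thesis by simp
qed

lemma mpoly_tensor_mconst:
  assumes "vector_space sA" "\<And>c a. sA c a = \<phi> c * a"
  shows "mpoly_tensor sA (mconst (\<phi> c) * q) = tensor_scale c (mpoly_tensor sA q)"
proof (induction q rule: mpoly_induct)
  case (single m a)
  show ?case
    by (simp add: mconst_def mult_single mpoly_tensor_single[OF assms(1)] assms(2)[symmetric]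
        tensor_simps[OF assms(1) mscale_vector_space])
next
  case (add p q)
  then show ?case
    by (simp add: distrib_left mpoly_tensor_add[OF assms(1)] fun_eq_iff)
qed

lemma coaction_N_linear:
  "Vector_Spaces.linear mscale tensor_scale (coaction_N :: 'k::field sym \<Rightarrow> _)"
proof -
  interpret G: gl2_point "const_G :: 'k \<Rightarrow> _" abs_gl2_ring scale_G by (rule gl2_point_G)
  interpret mG: comm_ring_morphism "\<lambda>c. mconst (const_G c) :: (2, 'k gl2_ring) mpoly"
    by (rule morphism_comp[OF G.\<phi> mconst_morphism])
  interpret \<sigma>: comm_ring_morphism "meval (\<lambda>c. mconst (const_G c))
    (\<lambda>i. \<Sum>j\<in>UNIV. mconst (coord_G (X i j)) * mvar j) :: 'k sym \<Rightarrow> (2, 'k gl2_ring) mpoly"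
    by (rule mG.meval_morphism)
  show ?thesis
    unfolding Vector_Spaces.linear_iff
  proof (intro conjI allI mscale_vector_space vector_space_tensor_scale)
    fix p q :: "'k sym" and c :: 'k
    show "coaction_N (p + q) = coaction_N p + coaction_N q"
      by (simp only: coaction_N_def coaction_G_def \<sigma>.hom_add mpoly_tensor_add[OF G.sA_vector_space]
          tensor_map_add)
    show "coaction_N (mscale c p) = tensor_scale c (coaction_N p)"
      by (simp only: coaction_N_def coaction_G_def mscale_def \<sigma>.hom_mult mG.meval_mconst
          mpoly_tensor_mconst[OF G.sA_vector_space scale_G_def] tensor_map_scale)
  qed
qed

text \<open>By \<open>bilinear_comult_slice\<close> the form is bilinear whenever \<gamma> is
  trilinear, so \<open>tensor\<close> really evaluates it and does not return its default 0.\<close>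

lemma comult_tensor_id_tensor:
  assumes "vector_space sV"
  shows "comult_tensor_id scale_N sV comult_N (tensor scale_N sV (c :: 'k::field nrm_ring) v) =
    (\<lambda>\<gamma>. if trilinear scale_N scale_N sV \<gamma> then comult_N c (\<lambda>a b. \<gamma> a b v) else 0)"
  unfolding comult_tensor_id_def tensor_def
  using bilinear_comult_slice[OF _ vector_space_scale_N assms comult_N_linear comult_N_in_tensor_product]
  by (auto simp: fun_eq_iff)

lemma id_tensor_coaction_tensor:
  "id_tensor_coaction scale_N mscale coaction_N (tensor scale_N mscale (c :: 'k::field nrm_ring) v) =
    (\<lambda>\<gamma>. if trilinear scale_N scale_N mscale \<gamma> then coaction_N v (\<gamma> c) else 0)"
  unfolding id_tensor_coaction_def tensor_def
  using bilinear_coaction_slice[OF _ vector_space_scale_N mscale_vector_space coaction_N_linear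
      coaction_N_in_tensor_product]
  by (auto simp: fun_eq_iff)

lemma comult_tensor_id_add:
  "comult_tensor_id sC sV \<Delta> (S + T) = comult_tensor_id sC sV \<Delta> S + comult_tensor_id sC sV \<Delta> T"
  by (auto simp: comult_tensor_id_def fun_eq_iff)

lemma comult_tensor_id_scale:
  "comult_tensor_id sC sV \<Delta> (tensor_scale c T) = tensor_scale c (comult_tensor_id sC sV \<Delta> T)"
  by (auto simp: comult_tensor_id_def fun_eq_iff)

lemma id_tensor_coaction_add:
  "id_tensor_coaction sC sV \<rho> (S + T) = id_tensor_coaction sC sV \<rho> S + id_tensor_coaction sC sV \<rho> T"
  by (auto simp: id_tensor_coaction_def fun_eq_iff)

lemma id_tensor_coaction_scale:
  "id_tensor_coaction sC sV \<rho> (tensor_scale c T) = tensor_scale c (id_tensor_coaction sC sV \<rho> T)"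
  by (auto simp: id_tensor_coaction_def fun_eq_iff)

lemma coaction_N_coassoc_sym_vec:
  assumes "1 \<le> d" "i \<le> d"
  shows "comult_tensor_id scale_N mscale comult_N (coaction_N (sym_vec d i :: 'k::field sym)) =
    id_tensor_coaction scale_N mscale coaction_N (coaction_N (sym_vec d i))"
proof -
  have dd: "d - (d - i) = i" "d - i \<le> d" "1 \<le> (d - i) + i" using assms by auto
  note co = coaction_N_sym_vec[OF assms, where ?'k = 'k]
    coaction_N_sym_vec[OF assms(1) dd(2), where ?'k = 'k, unfolded dd(1)]
  show ?thesis
    unfolding co comult_tensor_id_add id_tensor_coaction_add
      comult_tensor_id_tensor[OF mscale_vector_space] id_tensor_coaction_tensor
      comult_N_monomial[OF dd(3) two_neq_one(2)]
    \<comment> \<open>Comultiplication produces powers of x_21 before x_12 and of x_22 before x_11,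
      the coaction on v_(d-i) the opposite order; the two instances of commutativity align
      them.\<close>
    by (simp add: fun_eq_iff tensor_def trilinear_slice mult.commute[of "coord_N (X 2 1) ^ (d - i)"]
        mult.commute[of "coord_N (X 2 2) ^ (d - i)"])
qed

lemma coaction_N_counit_sym_vec:
  assumes "1 \<le> d" "i \<le> d"
  shows "tensor_map (*) mscale counit_N id (coaction_N (sym_vec d i :: 'k::field sym)) =
    tensor (*) mscale 1 (sym_vec d i)"
proof -
  interpret e: comm_ring_morphism "counit_N :: 'k nrm_ring \<Rightarrow> 'k" by (rule counit_N_morphism)
  have idl: "Vector_Spaces.linear (mscale :: 'k \<Rightarrow> 'k sym \<Rightarrow> _) mscale id"
    using mscale_vector_space by (auto simp: Vector_Spaces.linear_iff)
  \<comment> \<open>At the identity matrix both u_1 and u_2 vanish, and one exponent is positive: i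
    itself, or d when i = 0.\<close>
  have "counit_N (coord_N (X 1 2) ^ (d - i) * coord_N (X 2 1) ^ i) = (0 :: 'k)"
    using assms by (cases "i = 0") (simp_all add: e.hom_mult morphism_power[OF counit_N_morphism] counit_N_simps)
  moreover have "counit_N (coord_N (X 1 1) ^ (d - i) * coord_N (X 2 2) ^ i) = (1 :: 'k)"
    by (simp add: e.hom_mult morphism_power[OF counit_N_morphism] counit_N_simps)
  ultimately show ?thesis
    by (simp add: coaction_N_sym_vec[OF assms] tensor_map_add tensor_map_tensor[OF counit_N_linear idl]
        tensor_simps(5)[OF vector_space_mult mscale_vector_space])
qed

section \<open>The spanning vectors of Sym^d(V)^i\<close>

lemma sym_part_induct [consumes 1, case_names lincomb]:
  assumes "w \<in> sym_part d i"
    and "\<And>a b. P (mscale a (sym_vec d i) + mscale b (sym_vec d (d - i)))"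
  shows "P w"
proof -
  interpret V: vector_space "mscale :: 'a \<Rightarrow> 'a sym \<Rightarrow> _" by (rule mscale_vector_space)
  obtain a b where "w - mscale a (sym_vec d i) = mscale b (sym_vec d (d - i))"
    using assms(1) by (auto simp: sym_part_def V.span_breakdown_eq V.span_singleton)
  then have "w = mscale a (sym_vec d i) + mscale b (sym_vec d (d - i))"
    by (simp add: algebra_simps)
  with assms(2) show ?thesis by simp
qed

lemma subspace_sym_part: "module.subspace mscale (sym_part d i :: 'k::field sym set)"
  unfolding sym_part_def
  by (rule module.subspace_span) (simp add: module_iff_vector_space mscale_vector_space)

lemma sym_vec_in_sym_part:
  "sym_vec d i \<in> (sym_part d i :: 'k::field sym set)"
  "sym_vec d (d - i) \<in> (sym_part d i :: 'k sym set)"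
proof -
  interpret V: vector_space "mscale :: 'k \<Rightarrow> 'k sym \<Rightarrow> _" by (rule mscale_vector_space)
  show "sym_vec d i \<in> (sym_part d i :: 'k sym set)" "sym_vec d (d - i) \<in> (sym_part d i :: 'k sym set)"
    unfolding sym_part_def by (auto intro: V.span_base)
qed

lemma sym_vec_nonzero: "sym_vec d i \<noteq> (0 :: 'k::field sym)"
proof -
  have "sym_vec d i = (Poly_Mapping.single (Poly_Mapping.single 1 (d - i) + Poly_Mapping.single 2 i) 1 :: 'k sym)"
    by (simp add: sym_vec_def mvar_power mult_single)
  then show ?thesis by (metis lookup_single_eq lookup_zero zero_neq_one)
qed

lemma comodule_sym_part:
  assumes "1 \<le> d" "i \<le> d"
  shows "comodule (scale_N :: 'k::field \<Rightarrow> _) comult_N counit_N mscale (sym_part d i) coaction_N"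
  unfolding comodule_def
proof (intro conjI ballI)
  show "module.subspace mscale (sym_part d i :: 'k sym set)" by (rule subspace_sym_part)
  show "Vector_Spaces.linear mscale tensor_scale (coaction_N :: 'k sym \<Rightarrow> _)"
    by (rule coaction_N_linear)
  have dd: "d - (d - i) = i" "d - i \<le> d" using assms by auto
  note lin = coaction_N_linear[unfolded Vector_Spaces.linear_iff]
  note TP = module.subspace_add[OF module_tensor_scale subspace_tensor_product]
    module.subspace_scale[OF module_tensor_scale subspace_tensor_product]
  fix w :: "'k sym" assume w: "w \<in> sym_part d i"
  have 1: "coaction_N (sym_vec d i :: 'k sym) \<in> tensor_product scale_N mscale UNIV (sym_part d i)"
    unfolding coaction_N_sym_vec[OF assms]
    by (intro TP tensor_in_tensor_product) (auto intro: sym_vec_in_sym_part)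
  have 2: "coaction_N (sym_vec d (d - i) :: 'k sym) \<in> tensor_product scale_N mscale UNIV (sym_part d i)"
    unfolding coaction_N_sym_vec[OF assms(1) dd(2)] dd
    by (intro TP tensor_in_tensor_product) (auto intro: sym_vec_in_sym_part)
  from w show "coaction_N w \<in> tensor_product scale_N mscale UNIV (sym_part d i)"
    by (induction rule: sym_part_induct) (simp only: lin, intro TP 1 2)
  from w show "comult_tensor_id scale_N mscale comult_N (coaction_N w) =
      id_tensor_coaction scale_N mscale coaction_N (coaction_N w)"
    by (induction rule: sym_part_induct)
      (simp only: lin comult_tensor_id_add comult_tensor_id_scale id_tensor_coaction_add
        id_tensor_coaction_scale coaction_N_coassoc_sym_vec[OF assms]
        coaction_N_coassoc_sym_vec[OF assms(1) dd(2)])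
  from w show "tensor_map (*) mscale counit_N id (coaction_N w) = tensor (*) mscale 1 w"
    by (induction rule: sym_part_induct)
      (simp only: lin tensor_map_add tensor_map_scale coaction_N_counit_sym_vec[OF assms]
        coaction_N_counit_sym_vec[OF assms(1) dd(2)] tensor_simps[OF vector_space_mult mscale_vector_space])
qed


section \<open>Irreducibility\<close>

text \<open>The universal property of k[N]: a matrix over an algebra, with inverse determinant
  supplied, is a point of N once the products of generators of I_1 and I_2 vanish on it. It is what
  produces homomorphisms out of the double quotient.\<close>

lemma nrm_ring_universal:
  fixes x :: "gl2_var \<Rightarrow> 'a::comm_ring_1" and \<phi> :: "'k::field \<Rightarrow> 'a"
  assumes \<phi>: "comm_ring_morphism \<phi>" and det: "x Dinv * detD x = 1"
    and zero: "\<And>i j l. i \<noteq> j \<Longrightarrow> x (X i j) * x (X l l) = 0"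
  obtains g where "comm_ring_morphism g" "\<And>v. g (coord_N v) = x v" "\<And>c. g (const_N c) = \<phi> c"
proof -
  interpret \<phi>: comm_ring_morphism \<phi> by fact
  interpret m: comm_ring_morphism "meval \<phi> x" by (rule \<phi>.meval_morphism)
  interpret G: comm_ring_morphism "abs_gl2_ring :: (gl2_var, 'k) mpoly \<Rightarrow> _" by (rule abs_G_morphism)
  interpret N: gl2_point "const_N :: 'k \<Rightarrow> _" proj_N scale_N by (rule gl2_point_N)
  \<comment> \<open>\<open>H\<close> is the image in k[G] of the kernel of evaluation at
    \<open>x\<close>. It is an ideal because the quotient map is surjective, and it contains the
    generators of I_1 I_2.\<close>
  define H where "H = {a :: 'k gl2_ring. \<exists>p. abs_gl2_ring p = a \<and> meval \<phi> x p = 0}"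
  have "is_ideal H"
    unfolding is_ideal_iff
  proof (intro conjI ballI allI)
    show "0 \<in> H" unfolding H_def using G.hom_zero m.hom_zero by blast
    fix a c :: "'k gl2_ring" assume "a \<in> H"
    then obtain p where p: "abs_gl2_ring p = a" "meval \<phi> x p = 0" by (auto simp: H_def)
    obtain r where r: "c = abs_gl2_ring r" using abs_gl2_ring_surj ..
    show "c * a \<in> H" unfolding H_def
      by (intro CollectI exI[of _ "r * p"]) (simp add: p r G.hom_mult m.hom_mult)
    assume "c \<in> H"
    then obtain q where q: "abs_gl2_ring q = c" "meval \<phi> x q = 0" by (auto simp: H_def)
    show "a + c \<in> H" unfolding H_def
      by (intro CollectI exI[of _ "p + q"]) (simp add: p q G.hom_add m.hom_add)
  qed
  moreover have "coord_G (X i j) * coord_G (X l l) \<in> H" if "i \<noteq> j" for i j l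
    unfolding H_def
    by (intro CollectI exI[of _ "mvar (X i j) * mvar (X l l)"])
      (simp add: coord_G.abs_eq G.hom_mult m.hom_mult zero that)
  ultimately have H: "ideal_prod ideal_I1 ideal_I2 \<subseteq> H"
    unfolding ideal_I1_def ideal_I2_def by (intro ideal_prod_minimal) auto
  have ker: "meval \<phi> x p = meval \<phi> x q" if "proj_N p = proj_N q" for p q
  proof -
    have "abs_gl2_ring p - abs_gl2_ring q \<in> ideal_prod ideal_I1 ideal_I2"
      using that by (simp add: nrm_ring.abs_eq_iff)
    then obtain r where r: "abs_gl2_ring r = abs_gl2_ring (p - q)" "meval \<phi> x r = 0"
      using H by (auto simp: H_def G.hom_diff)
    \<comment> \<open>The polynomials \<open>r\<close> and \<open>p - q\<close> have the same class
      in k[G], so they differ by an element of \<open>gl2_ideal\<close>, on which evaluation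
      vanishes by the determinant condition.\<close>
    then have "meval \<phi> x (r - (p - q)) = 0"
      by (intro \<phi>.gl2_ideal_kernel[OF _ det]) (simp add: gl2_ring.abs_eq_iff)
    with r(2) show ?thesis by (simp add: m.hom_diff)
  qed
  define g where "g a = meval \<phi> x (SOME p. a = proj_N p)" for a :: "'k nrm_ring"
  have g: "g (proj_N p) = meval \<phi> x p" for p
    unfolding g_def by (rule ker) (metis (mono_tags, lifting) someI)
  show thesis
  proof
    show "comm_ring_morphism g"
    proof
      show "g 1 = 1" unfolding N.\<pi>.hom_one[symmetric] g by (rule m.hom_one)
      fix a b :: "'k nrm_ring"
      obtain p where p: "a = proj_N p" using proj_N_surj ..
      obtain q where q: "b = proj_N q" using proj_N_surj ..
      show "g (a + b) = g a + g b" unfolding p q N.\<pi>.hom_add[symmetric] g by (rule m.hom_add)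
      show "g (a * b) = g a * g b" unfolding p q N.\<pi>.hom_mult[symmetric] g by (rule m.hom_mult)
    qed
    show "g (coord_N v) = x v" for v unfolding coord_N_eq g by simp
    show "g (const_N c) = \<phi> c" for c unfolding N.\<pi>_mconst[symmetric] g by simp
  qed
qed

lemma lookup_single_0_mult:
  "Poly_Mapping.lookup (Poly_Mapping.single 0 c * q) n = c * Poly_Mapping.lookup q n"
  by (simp add: mult_map_scale_conv_mult[symmetric] map.rep_eq when_def)

text \<open>With its convolution product, \<open>int \<Rightarrow>\<^sub>0 'k\<close> is the ring of
  Laurent polynomials in s; the functional is a homomorphism into it followed by the coefficient of
  s^n. Formal exponents separate monomials over every field, whereas values at k-points would not
  over a finite one.\<close>

lemma nrm_ring_laurent_functional:
  fixes x :: "gl2_var \<Rightarrow> int \<Rightarrow>\<^sub>0 'k::field"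
  assumes "x Dinv * detD x = 1" "\<And>i j l. i \<noteq> j \<Longrightarrow> x (X i j) * x (X l l) = 0"
  obtains f where "Vector_Spaces.linear scale_N (*) f"
    "\<And>v w a b. f (coord_N v ^ a * coord_N w ^ b) = Poly_Mapping.lookup (x v ^ a * x w ^ b) n"
proof -
  have "comm_ring_morphism (Poly_Mapping.single 0 :: 'k \<Rightarrow> int \<Rightarrow>\<^sub>0 'k)"
    by unfold_locales (simp_all add: single_add mult_single)
  from nrm_ring_universal[of _ x, OF this assms] obtain g
    where g: "comm_ring_morphism g" "\<And>v. g (coord_N v) = x v"
      "\<And>c. g (const_N c) = Poly_Mapping.single 0 c" by metis
  interpret g: comm_ring_morphism g by fact
  show thesis
  proof
    show "Vector_Spaces.linear scale_N (*) (\<lambda>a. Poly_Mapping.lookup (g a) n)"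
      using vector_space_scale_N vector_space_mult
      by (simp add: Vector_Spaces.linear_iff g.hom_add g.hom_mult lookup_add scale_N_def g
          lookup_single_0_mult)
  qed (simp add: g.hom_mult morphism_power[OF g(1)] g)
qed

lemma single_power: "Poly_Mapping.single (1::int) (1::'k::field) ^ n = Poly_Mapping.single (int n) 1"
  by (induction n) (simp_all add: mult_single)

lemma torus_functional:
  obtains f :: "'k::field nrm_ring \<Rightarrow> 'k" where "Vector_Spaces.linear scale_N (*) f"
    "\<And>a b. f (coord_N (X 1 1) ^ a * coord_N (X 2 2) ^ b) = (if a = n then 1 else 0)"
    "\<And>a b. 1 \<le> a + b \<Longrightarrow> f (coord_N (X 1 2) ^ a * coord_N (X 2 1) ^ b) = 0"
proof -
  \<comment> \<open>The diagonal matrix with entries s and 1 has determinant s, so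
    \<open>Dinv\<close> goes to s^(-1). The exponent of s then records that of t_1.\<close>
  define x :: "gl2_var \<Rightarrow> int \<Rightarrow>\<^sub>0 'k" where
    "x v = (case v of X i j \<Rightarrow> if i = j then if i = 1 then Poly_Mapping.single 1 1 else 1 else 0
      | Dinv \<Rightarrow> Poly_Mapping.single (- 1) 1)" for v
  have "x Dinv * detD x = 1" by (simp add: x_def detD_def mult_single)
  moreover have "x (X i j) * x (X l l) = 0" if "i \<noteq> j" for i j l using that by (simp add: x_def)
  ultimately obtain f where f: "Vector_Spaces.linear scale_N (*) f"
    "\<And>v w a b. f (coord_N v ^ a * coord_N w ^ b) = Poly_Mapping.lookup (x v ^ a * x w ^ b) (int n)"
    using nrm_ring_laurent_functional[of x "int n"] by blast
  show thesis
  proof (rule that[OF f(1)])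
    fix a b :: nat
    show "f (coord_N (X 1 1) ^ a * coord_N (X 2 2) ^ b) = (if a = n then 1 else 0)"
      by (simp add: f(2) x_def single_power lookup_single when_def)
    show "f (coord_N (X 1 2) ^ a * coord_N (X 2 1) ^ b) = 0" if "1 \<le> a + b"
      \<comment> \<open>The bound on a + b excludes the empty monomial 1, which would not be sent to
        the zero Laurent polynomial.\<close>
      using that unfolding f(2) by (cases "a = 0") (simp_all add: x_def power_0_left)
  qed
qed

lemma antidiagonal_functional:
  obtains f :: "'k::field nrm_ring \<Rightarrow> 'k" where "Vector_Spaces.linear scale_N (*) f"
    "\<And>a b. f (coord_N (X 1 2) ^ a * coord_N (X 2 1) ^ b) = (if a = n then 1 else 0)"
    "\<And>a b. 1 \<le> a + b \<Longrightarrow> f (coord_N (X 1 1) ^ a * coord_N (X 2 2) ^ b) = 0"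
proof -
  \<comment> \<open>The antidiagonal matrix with x_12 = s and x_21 = 1 has determinant -s, which
    explains the sign of \<open>Dinv\<close>.\<close>
  define x :: "gl2_var \<Rightarrow> int \<Rightarrow>\<^sub>0 'k" where
    "x v = (case v of X i j \<Rightarrow> if i = j then 0 else if i = 1 then Poly_Mapping.single 1 1 else 1
      | Dinv \<Rightarrow> - Poly_Mapping.single (- 1) 1)" for v
  have "x Dinv * detD x = 1" by (simp add: x_def detD_def mult_single)
  moreover have "x (X i j) * x (X l l) = 0" for i j l by (simp add: x_def)
  ultimately obtain f where f: "Vector_Spaces.linear scale_N (*) f"
    "\<And>v w a b. f (coord_N v ^ a * coord_N w ^ b) = Poly_Mapping.lookup (x v ^ a * x w ^ b) (int n)"
    using nrm_ring_laurent_functional[of x "int n"] by blast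
  show thesis
  proof (rule that[OF f(1)])
    fix a b :: nat
    show "f (coord_N (X 1 2) ^ a * coord_N (X 2 1) ^ b) = (if a = n then 1 else 0)"
      by (simp add: f(2) x_def single_power lookup_single when_def)
    show "f (coord_N (X 1 1) ^ a * coord_N (X 2 2) ^ b) = 0" if "1 \<le> a + b"
      using that unfolding f(2) by (cases "a = 0") (simp_all add: x_def power_0_left)
  qed
qed

text \<open>The vector is (f \<otimes> id) applied to the coaction of the given element, collected
  by basis vector: each of v_i and v_(d-i) contributes its t-monomial to itself and its u-monomial
  to the other.\<close>

lemma subcomodule_contraction:
  fixes f :: "'k::field nrm_ring \<Rightarrow> 'k"
  assumes "1 \<le> d" "i \<le> d" "subcomodule scale_N mscale U (sym_part d i) coaction_N"
    and f: "Vector_Spaces.linear scale_N (*) f"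
    and u: "mscale a (sym_vec d i) + mscale b (sym_vec d (d - i)) \<in> U"
  shows "mscale (a * f (coord_N (X 1 1) ^ (d - i) * coord_N (X 2 2) ^ i) +
      b * f (coord_N (X 1 2) ^ i * coord_N (X 2 1) ^ (d - i))) (sym_vec d i) +
    mscale (a * f (coord_N (X 1 2) ^ (d - i) * coord_N (X 2 1) ^ i) +
      b * f (coord_N (X 1 1) ^ i * coord_N (X 2 2) ^ (d - i))) (sym_vec d (d - i)) \<in> U"
proof (rule contraction_in_subspace[OF _ _ mscale_vector_space f])
  let ?u = "mscale a (sym_vec d i) + mscale b (sym_vec d (d - i))"
  show "module.subspace mscale U" "coaction_N ?u \<in> tensor_product scale_N mscale UNIV U"
    using assms(3) u by (auto simp: subcomodule_def)
  fix \<phi> :: "'k sym \<Rightarrow> 'k" assume \<phi>: "Vector_Spaces.linear mscale (*) \<phi>"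
  have dd: "d - (d - i) = i" "d - i \<le> d" using assms by auto
  note co = coaction_N_sym_vec[OF assms(1,2), where ?'k = 'k]
    coaction_N_sym_vec[OF assms(1) dd(2), where ?'k = 'k, unfolded dd(1)]
  have "coaction_N ?u = tensor_scale a (coaction_N (sym_vec d i)) + tensor_scale b (coaction_N (sym_vec d (d - i)))"
    using coaction_N_linear[where ?'k = 'k] by (simp add: Vector_Spaces.linear_iff)
  moreover have "tensor scale_N mscale c v (\<lambda>c v. f c * \<phi> v) = f c * \<phi> v" for c v
    by (simp add: tensor_def bilinear_mult[OF f \<phi>])
  ultimately show "coaction_N ?u (\<lambda>c v. f c * \<phi> v) =
    \<phi> (mscale (a * f (coord_N (X 1 1) ^ (d - i) * coord_N (X 2 2) ^ i) +
      b * f (coord_N (X 1 2) ^ i * coord_N (X 2 1) ^ (d - i))) (sym_vec d i) +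
    mscale (a * f (coord_N (X 1 2) ^ (d - i) * coord_N (X 2 1) ^ i) +
      b * f (coord_N (X 1 1) ^ i * coord_N (X 2 2) ^ (d - i))) (sym_vec d (d - i)))"
    using \<phi> by (simp add: co Vector_Spaces.linear_iff algebra_simps)
qed

theorem theorem7p1:
  fixes d i :: nat
  assumes "1 \<le> d" and "i \<le> d"
  shows "irreducible_comodule (scale_N :: 'k::field \<Rightarrow> 'k nrm_ring \<Rightarrow> 'k nrm_ring) comult_N counit_N
    mscale (sym_part d i) coaction_N"
  unfolding irreducible_comodule_def
proof (intro conjI allI impI)
  interpret V: vector_space "mscale :: 'k \<Rightarrow> 'k sym \<Rightarrow> _" by (rule mscale_vector_space)
  show "comodule (scale_N :: 'k \<Rightarrow> _) comult_N counit_N mscale (sym_part d i) coaction_N"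
    by (rule comodule_sym_part[OF assms])
  show "sym_part d i \<noteq> ({0} :: 'k sym set)"
    using sym_vec_in_sym_part(1)[of d i] sym_vec_nonzero[of d i] by blast
  fix U :: "'k sym set"
  assume sub: "subcomodule scale_N mscale U (sym_part d i) coaction_N"
  then have U: "V.subspace U" "U \<subseteq> sym_part d i" by (auto simp: subcomodule_def)
  let ?v = "sym_vec d i :: 'k sym" and ?v' = "sym_vec d (d - i) :: 'k sym"
  have unscale: "v \<in> U" if "mscale c v \<in> U" "c \<noteq> 0" for c v
    using V.subspace_scale[OF U(1) that(1), of "inverse c"] that(2) by simp
  have pos: "1 \<le> (d - i) + i" "1 \<le> i + (d - i)" using assms by auto
  have "U = sym_part d i" if "U \<noteq> {0}"
  proof -
    obtain u where u: "u \<in> U" "u \<noteq> 0" using \<open>U \<noteq> {0}\<close> V.subspace_0[OF U(1)] by blast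
    from u(1) U(2) have "u \<in> sym_part d i" by blast
    then obtain a b where ab: "u = mscale a ?v + mscale b ?v'"
      by (induction rule: sym_part_induct) blast
    note contr = subcomodule_contraction[OF assms sub _ u(1)[unfolded ab]]
    have "?v \<in> U \<and> ?v' \<in> U"
    proof (cases "d - i = i")
      \<comment> \<open>For d = 2i the two vectors coincide, so a nonzero \<open>u\<close> is
        already a nonzero multiple of v_i and no contraction is required.\<close>
      case True
      then have "u = mscale (a + b) ?v" by (simp add: ab V.scale_left_distrib)
      with u show ?thesis using unscale[of "a + b" ?v] True by auto
    next
      case False
      \<comment> \<open>In the coaction v_i carries t_1^(d-i) and v_(d-i) carries t_1^i, so the
        coefficient of s^n selects by these exponents, while the u-terms are killed.\<close>
      have t: "mscale (a * (if d - i = n then 1 else 0)) ?v + mscale (b * (if i = n then 1 else 0)) ?v' \<in> U" for n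
      proof -
        obtain f :: "'k nrm_ring \<Rightarrow> 'k" where f: "Vector_Spaces.linear scale_N (*) f"
          "\<And>a b. f (coord_N (X 1 1) ^ a * coord_N (X 2 2) ^ b) = (if a = n then 1 else 0)"
          "\<And>a b. 1 \<le> a + b \<Longrightarrow> f (coord_N (X 1 2) ^ a * coord_N (X 2 1) ^ b) = 0"
          using torus_functional[of n] by blast
        show ?thesis using contr[OF f(1)] by (simp only: f(2) f(3)[OF pos(1)] f(3)[OF pos(2)] mult_zero_right add_0_left add_0_right)
      qed
      \<comment> \<open>The other component of N does the same with u_1, but the coaction there
        interchanges v_i and v_(d-i), so \<open>a\<close> and \<open>b\<close> change
        places.\<close>
      have w: "mscale (b * (if i = n then 1 else 0)) ?v + mscale (a * (if d - i = n then 1 else 0)) ?v' \<in> U" for n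
      proof -
        obtain f :: "'k nrm_ring \<Rightarrow> 'k" where f: "Vector_Spaces.linear scale_N (*) f"
          "\<And>a b. f (coord_N (X 1 2) ^ a * coord_N (X 2 1) ^ b) = (if a = n then 1 else 0)"
          "\<And>a b. 1 \<le> a + b \<Longrightarrow> f (coord_N (X 1 1) ^ a * coord_N (X 2 2) ^ b) = 0"
          using antidiagonal_functional[of n] by blast
        show ?thesis using contr[OF f(1)] by (simp only: f(2) f(3)[OF pos(1)] f(3)[OF pos(2)] mult_zero_right add_0_left add_0_right)
      qed
      \<comment> \<open>Because d - i and i differ, each of the choices n = d - i and n = i leaves
        exactly one summand. Whichever of \<open>a\<close>, \<open>b\<close> is nonzero then yields
        both spanning vectors.\<close>
      have "mscale a ?v \<in> U" "mscale b ?v' \<in> U" "mscale b ?v \<in> U" "mscale a ?v' \<in> U"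
        using t[of "d - i"] t[of i] w[of i] w[of "d - i"] False by simp_all
      moreover have "a \<noteq> 0 \<or> b \<noteq> 0" using u(2) ab by auto
      ultimately show ?thesis using unscale by blast
    qed
    then have "sym_part d i \<subseteq> U"
      unfolding sym_part_def by (intro V.span_minimal U(1)) auto
    with U(2) show ?thesis by blast
  qed
  then show "U = {0} \<or> U = sym_part d i" by blast
qed

end
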